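(* Let $n \in \mathbb{N}$, $p>1$, and let $\omega\in[a_p,\omega_p)$, where $$a_p:=\frac{p(7p-5)}{4(p+1)(2p-1)^2}, \qquad \omega_p:=\frac{p}{(p+1)^2}.$$ Then the boundary value problem $$\begin{cases} u_{rr}+ \dfrac{n-1}{r}u_r -\omega u+u^p-u^{2p-1}=0 & \text{for } r>0, \\ u_r(0)=0, \\ \displaystyle \lim_{r \to \infty} u(r) =0 \end{cases}$$ has exactly one positive solution $u=u(r)$.
   Context: The exponent $p$ is a real number and $n$ is a positive integer. A solution means a classical solution, i.e. a real-valued function $u$ on $[0,\infty)$, twice continuously differentiable, satisfying the equation for every $r>0$ together with the stated conditions at $r=0$ and at infinity. The solution is positive if $u(r)>0$ for all $r\ge 0$. Subscripts $r$ denote derivatives with respect to $r$. (One has $0<a_p<\omega_p$ for every $p>1$.) *)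

theory Defs
  imports "HOL-Analysis.Analysis"
begin

definition a_crit :: "real \<Rightarrow> real" where
  "a_crit p = p * (7 * p - 5) / (4 * (p + 1) * (2 * p - 1)\<^sup>2)"

definition omega_crit :: "real \<Rightarrow> real" where
  "omega_crit p = p / (p + 1)\<^sup>2"

(* Only the values of u on {0..} matter: the derivatives are taken within {0..}, hence one-sided
   at 0, so that u is twice continuously differentiable up to the boundary point 0.  Since u is
   positive, powr is the ordinary real power. *)
definition positive_solution :: "nat \<Rightarrow> real \<Rightarrow> real \<Rightarrow> (real \<Rightarrow> real) \<Rightarrow> bool" where
  "positive_solution n p \<omega> u \<longleftrightarrow>
     (\<forall>r\<ge>0. u r > 0) \<and>
     (\<exists>u' u''.
        (\<forall>r\<ge>0. (u has_real_derivative u' r) (at r within {0..})) \<and>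
        (\<forall>r\<ge>0. (u' has_real_derivative u'' r) (at r within {0..})) \<and>
        continuous_on {0..} u'' \<and>
        (\<forall>r>0. u'' r + (real n - 1) / r * u' r
                 - \<omega> * u r + u r powr p - u r powr (2 * p - 1) = 0) \<and>
        u' 0 = 0) \<and>
     (u \<longlongrightarrow> 0) at_top"

end

theory Submission
  imports Defs
begin

text \<open>Write \<open>f x = - \<omega> x + x\<^sup>p - x\<^sup>2\<^sup>p\<^sup>-\<^sup>1\<close>, let \<open>F\<close> be its primitive with \<open>F 0 = 0\<close>, let
  \<open>\<beta>\<close> be the first positive zero of \<open>F\<close> and \<open>b\<close> the last zero of \<open>f\<close>.  The condition
  \<open>\<omega> < omega_crit p\<close> says that \<open>F\<close> becomes positive, and then \<open>f > 0\<close> on \<open>{\<beta>..<b}\<close>.  The condition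
  \<open>a_crit p \<le> \<omega>\<close> says that \<open>F\<close> is nonpositive at the inflection point of \<open>f\<close>, so that \<open>f\<close> is concave
  on \<open>{\<beta>..b}\<close> and \<open>f x / (x - \<beta>)\<close> is nonincreasing there.  Positive solutions take values in
  \<open>{0<..<b}\<close>, so \<open>f\<close> may be replaced by \<open>g\<close>, which is constant (zero) outside \<open>{0..b}\<close> and hence
  globally Lipschitz.  Throughout, \<open>N = n - 1\<close> and \<open>v = u'\<close>.

  Existence is by shooting.  The initial value problem is solved globally by a contraction argument
  (\<open>radial_sol_exists\<close>).  The energy \<open>v\<^sup>2 / 2 + F u\<close> decreases.  The initial values for which it
  becomes negative while \<open>u\<close> is still positive form an open set, and so do those for which \<open>u\<close>
  crosses zero; both are nonempty, the second because close to \<open>b\<close> little energy is lost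
  (\<open>crossing_solution\<close>), and they are disjoint, because zero cannot be reached with negative energy.
  Any other initial value in \<open>{0<..<b}\<close> gives a solution that is positive with nonnegative energy
  for all \<open>r\<close>, and such a solution decreases to zero (\<open>ground_state_of_nonneg\<close>).

  For uniqueness, describe a solution by its radius and its slope as functions of the level \<open>x = u\<close>.
  Take two distinct solutions; at low levels they do not cross, by a maximum principle
  (\<open>equal_of_low_crossing\<close>), so one of them is eventually the outer one.  Below their lowest crossing
  the outer solution has the smaller slope (\<open>slope_le_of_level_gt\<close>), which excludes that there is
  no crossing at all.  If the lowest crossing had level at most \<open>\<beta>\<close>, comparing
  \<open>r\<^sup>2\<^sup>N (v\<^sup>2 / 2 + F u)\<close>, which is monotone in the level because \<open>F < 0\<close>, would give the opposite
  inequality of the slopes (\<open>crossing_level_gt\<close>).  If the level is above \<open>\<beta>\<close>, the Wronskian of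
  the two functions \<open>u - \<beta>\<close> between this crossing and the preceding one, or \<open>r = 0\<close>, is monotone in the
  direction that contradicts the slopes at the crossings (\<open>no_crossing_above\<close>).\<close>

section \<open>Calculus on the half-line\<close>

lemma within_Ici_eq_at:
  fixes r :: real
  assumes "r > 0"
  shows "at r within {0..} = at r"
  using assms by (intro at_within_interior) auto

lemma last_zero:
  fixes f :: "real \<Rightarrow> real"
  assumes "a < b" and cont: "continuous_on {a..b} f" and fa: "f a \<le> 0" and fb: "f b > 0"
  obtains z where "a \<le> z" "z < b" "f z = 0" "\<And>x. z < x \<Longrightarrow> x \<le> b \<Longrightarrow> f x > 0"
proof -
  define Z where "Z = {x \<in> {a..b}. f x \<in> {0}}"
  have Zc: "closed Z" unfolding Z_def
    using continuous_closed_preimage[OF cont, of "{0}"] by (simp add: vimage_def Int_def)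
  have Zb: "bdd_above Z" unfolding Z_def by (auto intro: bdd_aboveI[of _ b])
  have zero: "\<exists>y\<in>Z. x \<le> y" if "f x \<le> 0" "a \<le> x" "x \<le> b" for x
    using IVT'[of f x 0 b] that fb continuous_on_subset[OF cont, of "{x..b}"]
    unfolding Z_def by fastforce
  have "Z \<noteq> {}" using zero[of a] fa \<open>a < b\<close> by auto
  then have z: "Sup Z \<in> Z" using Zb Zc by (intro closed_contains_Sup)
  show ?thesis
  proof
    show "a \<le> Sup Z" "f (Sup Z) = 0" using z by (auto simp: Z_def)
    show "Sup Z < b" using z fb by (auto simp: Z_def less_le)
    fix x assume x: "Sup Z < x" "x \<le> b"
    show "f x > 0"
    proof (rule ccontr)
      assume "\<not> f x > 0"
      then obtain y where "y \<in> Z" "x \<le> y" using zero[of x] x z by (auto simp: Z_def)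
      then show False using cSup_upper[OF _ Zb, of y] x by simp
    qed
  qed
qed

lemma first_zero:
  fixes f :: "real \<Rightarrow> real"
  assumes "a < b" and cont: "continuous_on {a..b} f" and fa: "f a < 0" and fb: "f b \<ge> 0"
  obtains z where "a < z" "z \<le> b" "f z = 0" "\<And>x. a \<le> x \<Longrightarrow> x < z \<Longrightarrow> f x < 0"
proof -
  have "continuous_on {-b..-a} (\<lambda>x. - f (- x))"
    by (intro continuous_intros continuous_on_compose2[OF cont]) auto
  then obtain y where y: "-b \<le> y" "y < -a" "- f (- y) = 0"
    "\<And>x. y < x \<Longrightarrow> x \<le> -a \<Longrightarrow> - f (- x) > 0"
    using last_zero[of "-b" "-a" "\<lambda>x. - f (- x)"] assms by auto
  show ?thesis
  proof (rule that[of "- y"])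
    fix x assume "a \<le> x" "x < - y"
    then show "f x < 0" using y(4)[of "- x"] by auto
  qed (use y in auto)
qed

text \<open>The differential inequality is required only where \<open>G > 0\<close>, which holds to the right of the
  last zero of \<open>G\<close>.\<close>

lemma gronwall_nonpos:
  fixes G G' :: "real \<Rightarrow> real"
  assumes ab: "a \<le> b" and cont: "continuous_on {a..b} G"
    and der: "\<And>x. a < x \<Longrightarrow> x < b \<Longrightarrow> (G has_real_derivative G' x) (at x)"
    and le: "\<And>x. a < x \<Longrightarrow> x < b \<Longrightarrow> G x > 0 \<Longrightarrow> G' x \<le> K * G x"
    and Ga: "G a \<le> 0"
  shows "G b \<le> 0"
proof (rule ccontr)
  assume neg: "\<not> G b \<le> 0"
  then have "a < b" using ab Ga by (cases "a = b") auto
  then obtain c where c: "a \<le> c" "c < b" "G c = 0" and pos: "\<And>x. c < x \<Longrightarrow> x \<le> b \<Longrightarrow> G x > 0"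
    using last_zero[OF _ cont Ga] neg by auto
  have "exp (- K * b) * G b \<le> exp (- K * c) * G c"
  proof (rule DERIV_nonpos_imp_decreasing_open[where f = "\<lambda>x. exp (- K * x) * G x"])
    show "c \<le> b" using c by simp
    show "continuous_on {c..b} (\<lambda>x. exp (- K * x) * G x)"
      by (intro continuous_intros continuous_on_subset[OF cont]) (use c in auto)
    fix x assume x: "c < x" "x < b"
    have "((\<lambda>x. exp (- K * x) * G x) has_real_derivative
       exp (- K * x) * (G' x - K * G x)) (at x)"
      using der[of x] x c by (auto intro!: derivative_eq_intros simp: algebra_simps)
    moreover have "exp (- K * x) * (G' x - K * G x) \<le> 0"
      using le[of x] pos[of x] x c by (intro mult_nonneg_nonpos) auto
    ultimately show "\<exists>y. ((\<lambda>x. exp (- K * x) * G x) has_real_derivative y) (at x) \<and> y \<le> 0"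
      by blast
  qed
  also have "\<dots> \<le> 0" using c by (simp add: mult_nonneg_nonpos)
  finally show False using neg by (simp add: mult_le_0_iff not_le)
qed

lemma antimono_bounded_tendsto_at_top:
  fixes E :: "real \<Rightarrow> real"
  assumes anti: "\<And>x y. 0 \<le> x \<Longrightarrow> x \<le> y \<Longrightarrow> E y \<le> E x"
    and lower: "\<And>x. 0 \<le> x \<Longrightarrow> m \<le> E x"
  obtains l where "(E \<longlongrightarrow> l) at_top" "\<And>x. 0 \<le> x \<Longrightarrow> l \<le> E x" "m \<le> l"
proof -
  define l where "l = Inf (E ` {0..})"
  have bdd: "bdd_below (E ` {0..})" using lower by (auto intro: bdd_belowI[of _ m])
  have le: "l \<le> E x" if "0 \<le> x" for x
    unfolding l_def by (rule cInf_lower) (use that bdd in auto)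
  have "m \<le> l" unfolding l_def by (rule cInf_greatest) (use lower in auto)
  moreover have "(E \<longlongrightarrow> l) at_top"
  proof (rule order_tendstoI)
    fix a assume "a < l"
    then show "eventually (\<lambda>x. a < E x) at_top"
      using le by (intro eventually_at_top_linorderI[of 0]) (meson less_le_trans)
  next
    fix a assume "l < a"
    then obtain x where "0 \<le> x" "E x < a"
      unfolding l_def using bdd by (auto simp: cInf_less_iff)
    then show "eventually (\<lambda>x. E x < a) at_top"
      using anti by (intro eventually_at_top_linorderI[of x]) (meson le_less_trans)
  qed
  ultimately show ?thesis using that le by blast
qed

text \<open>A convergent function whose derivative has a limit at infinity has derivative tending
  to zero; stated for any continuous quantity \<open>\<phi>\<close> of the derivative, so that it also applies when
  only \<open>\<phi> \<circ> v\<close> is known to converge.\<close>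

lemma limit_of_derivative_zero:
  fixes u v \<phi> :: "real \<Rightarrow> real"
  assumes der: "\<And>r. r > 0 \<Longrightarrow> (u has_real_derivative v r) (at r)"
    and u: "(u \<longlongrightarrow> l) at_top"
    and v: "((\<lambda>r. \<phi> (v r)) \<longlongrightarrow> k) at_top"
    and \<phi>: "isCont \<phi> 0"
  shows "k = \<phi> 0"
proof -
  have "\<exists>z. r < z \<and> z < r + 1 \<and> u (r + 1) - u r = v z" if "r > 0" for r
    using MVT2[of r "r + 1" u v] der that by auto
  then obtain \<xi> where \<xi>: "\<And>r. r > 0 \<Longrightarrow> r < \<xi> r \<and> \<xi> r < r + 1 \<and> u (r + 1) - u r = v (\<xi> r)"
    by metis
  have "filterlim \<xi> at_top at_top"
    by (rule filterlim_at_top_mono[OF filterlim_ident])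
       (use \<xi> in \<open>auto intro!: eventually_at_top_linorderI[of 1] less_imp_le\<close>)
  from filterlim_compose[OF v this] have 1: "((\<lambda>r. \<phi> (v (\<xi> r))) \<longlongrightarrow> k) at_top" .
  have "filterlim (\<lambda>r::real. r + 1) at_top at_top"
    by (rule filterlim_at_top_mono[OF filterlim_ident]) auto
  from tendsto_diff[OF filterlim_compose[OF u this] u]
  have "((\<lambda>r. u (r + 1) - u r) \<longlongrightarrow> 0) at_top" by simp
  then have "((\<lambda>r. v (\<xi> r)) \<longlongrightarrow> 0) at_top"
    by (rule Lim_transform_eventually) (use \<xi> in \<open>auto intro!: eventually_at_top_linorderI[of 1]\<close>)
  from isCont_tendsto_compose[OF \<phi> this] have "((\<lambda>r. \<phi> (v (\<xi> r))) \<longlongrightarrow> \<phi> 0) at_top" .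
  with 1 show ?thesis by (rule tendsto_unique[rotated]) simp
qed

section \<open>The radial initial value problem\<close>

text \<open>The pair \<open>(u, v)\<close> with \<open>v = u'\<close> solves \<open>u'' + (N / r) u' + g u = 0\<close> on \<open>{0..}\<close> with
  \<open>u' 0 = 0\<close>; here \<open>N\<close> is the dimension minus one.  At the singular point \<open>r = 0\<close> only continuity
  of \<open>v\<close> is required.\<close>

definition radial_sol :: "nat \<Rightarrow> (real \<Rightarrow> real) \<Rightarrow> (real \<Rightarrow> real) \<Rightarrow> (real \<Rightarrow> real) \<Rightarrow> bool" where
  "radial_sol N g u v \<longleftrightarrow>
     (\<forall>r\<ge>0. (u has_real_derivative v r) (at r within {0..})) \<and>
     continuous_on {0..} v \<and> v 0 = 0 \<and>
     (\<forall>r>0. (v has_real_derivative - (real N / r) * v r - g (u r)) (at r))"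

lemma radial_sol_u:
  "radial_sol N g u v \<Longrightarrow> r > 0 \<Longrightarrow> (u has_real_derivative v r) (at r)"
  unfolding radial_sol_def by (metis less_imp_le within_Ici_eq_at)

lemma radial_sol_v:
  "radial_sol N g u v \<Longrightarrow> r > 0 \<Longrightarrow>
    (v has_real_derivative - (real N / r) * v r - g (u r)) (at r)"
  unfolding radial_sol_def by blast

lemma radial_sol_cont_u: "radial_sol N g u v \<Longrightarrow> continuous_on {0..} u"
  unfolding radial_sol_def by (rule DERIV_continuous_on[of _ _ v]) simp

lemma radial_sol_cont_v: "radial_sol N g u v \<Longrightarrow> continuous_on {0..} v"
  and radial_sol_v0: "radial_sol N g u v \<Longrightarrow> v 0 = 0"
  unfolding radial_sol_def by auto

lemma continuous_on_Ici_at_right: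
  fixes f :: "real \<Rightarrow> real"
  assumes "continuous_on {0..} f"
  shows "(f \<longlongrightarrow> f 0) (at_right 0)"
proof -
  have "(f \<longlongrightarrow> f 0) (at 0 within {0..})"
    using assms unfolding continuous_on_def by simp
  then show ?thesis by (rule tendsto_within_subset) auto
qed

lemmas radial_sol_u_at_right_0 = continuous_on_Ici_at_right[OF radial_sol_cont_u]

lemma radial_sol_const: "g c = 0 \<Longrightarrow> radial_sol N g (\<lambda>_. c) (\<lambda>_. 0)"
  unfolding radial_sol_def by auto

text \<open>The flux \<open>r\<^sup>N v\<close> absorbs the first-order term.\<close>

lemma radial_sol_flux:
  assumes "radial_sol N g u v" "r > 0"
  shows "((\<lambda>r. r ^ N * v r) has_real_derivative - (r ^ N * g (u r))) (at r)"
proof -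
  have "((\<lambda>r. r ^ N * v r) has_real_derivative
     r ^ N * (- (real N / r) * v r - g (u r)) + real N * r ^ (N - 1) * v r) (at r)"
    using radial_sol_v[OF assms] by (auto intro!: derivative_eq_intros)
  moreover have "r ^ N * (- (real N / r) * v r - g (u r)) + real N * r ^ (N - 1) * v r
      = - (r ^ N * g (u r))"
    using assms(2) by (cases N) (auto simp: field_simps)
  ultimately show ?thesis by simp
qed

text \<open>Bounds for the derivative of \<open>w\<^sup>2 + z\<^sup>2\<close>, where \<open>w\<close> is the difference of two solutions,
  \<open>z\<close> that of their derivatives, \<open>d\<close> that of the nonlinear terms, and \<open>k = N / r\<close>.  The upper bound
  does not involve \<open>k\<close>.\<close>

lemma difference_energy_upper:
  fixes w z d k L :: real
  assumes d: "\<bar>d\<bar> \<le> L * \<bar>w\<bar>" and "k \<ge> 0" "L \<ge> 0"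
  shows "2 * w * z + 2 * z * (- k * z - d) \<le> (1 + L) * (w\<^sup>2 + z\<^sup>2)"
proof -
  define h P where "h = w\<^sup>2 + z\<^sup>2" and "P = \<bar>w\<bar> * \<bar>z\<bar>"
  have P: "2 * P \<le> h"
    using sum_squares_bound[of "\<bar>w\<bar>" "\<bar>z\<bar>"] by (simp add: h_def P_def)
  have "\<bar>z * d\<bar> \<le> L * P"
    using mult_left_mono[OF d, of "\<bar>z\<bar>"] by (simp add: abs_mult P_def mult_ac)
  moreover have "\<bar>w * z\<bar> \<le> P" by (simp add: abs_mult P_def)
  moreover have "k * (z * z) \<ge> 0" using \<open>k \<ge> 0\<close> by simp
  moreover have "L * (2 * P) \<le> L * h" using P \<open>L \<ge> 0\<close> by (rule mult_left_mono)
  moreover have "2 * w * z + 2 * z * (- k * z - d) = 2 * (w * z) - 2 * (k * (z * z)) - 2 * (z * d)"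
    by (simp add: algebra_simps)
  ultimately have "2 * w * z + 2 * z * (- k * z - d) \<le> h + L * h" using P by linarith
  then show ?thesis by (simp add: h_def algebra_simps)
qed

lemma difference_energy_lower:
  fixes w z d k L :: real
  assumes d: "\<bar>d\<bar> \<le> L * \<bar>w\<bar>" and "k \<ge> 0" "L \<ge> 0"
  shows "- ((1 + L + 2 * k) * (w\<^sup>2 + z\<^sup>2)) \<le> 2 * w * z + 2 * z * (- k * z - d)"
proof -
  have "2 * (- w) * z + 2 * z * (- 0 * z - (- d)) \<le> (1 + L) * ((- w)\<^sup>2 + z\<^sup>2)"
    by (rule difference_energy_upper) (use assms in auto)
  moreover have "k * (z * z) \<le> k * (w\<^sup>2 + z\<^sup>2)"
    using \<open>k \<ge> 0\<close> by (intro mult_left_mono) (auto simp: power2_eq_square)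
  ultimately show ?thesis by (simp add: algebra_simps)
qed

locale lipschitz_nonlinearity =
  fixes g :: "real \<Rightarrow> real" and L :: real
  assumes L_pos: "L > 0" and lip: "\<bar>g x - g y\<bar> \<le> L * \<bar>x - y\<bar>"
begin

lemma continuous_g: "continuous_on S g"
proof -
  have "L-lipschitz_on S g"
    by (rule lipschitz_onI) (use L_pos lip in \<open>simp_all add: dist_real_def\<close>)
  then show ?thesis by (rule lipschitz_on_continuous_on)
qed

text \<open>The singular friction term \<open>- (N / r) w'\<close> has the right sign going outwards, so that the
  estimate holds uniformly down to \<open>r = 0\<close>.\<close>

lemma continuous_dependence:
  assumes 1: "radial_sol N g u1 v1" and 2: "radial_sol N g u2 v2" and r: "r \<ge> 0"
  shows "(u1 r - u2 r)\<^sup>2 + (v1 r - v2 r)\<^sup>2 \<le> exp ((1 + L) * r) * (u1 0 - u2 0)\<^sup>2"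
proof -
  define h where "h = (\<lambda>r. (u1 r - u2 r)\<^sup>2 + (v1 r - v2 r)\<^sup>2)"
  have "exp (- (1 + L) * r) * h r \<le> exp (- (1 + L) * 0) * h 0"
  proof (rule DERIV_nonpos_imp_decreasing_open[OF r])
    show "continuous_on {0..r} (\<lambda>r. exp (- (1 + L) * r) * h r)"
      unfolding h_def using radial_sol_cont_u[OF 1] radial_sol_cont_u[OF 2]
        radial_sol_cont_v[OF 1] radial_sol_cont_v[OF 2]
      by (intro continuous_intros) (auto intro: continuous_on_subset)
    fix x assume x: "0 < x" "x < r"
    let ?w = "u1 x - u2 x" and ?z = "v1 x - v2 x"
    let ?h = "2 * ?w * ?z + 2 * ?z * (- (real N / x) * ?z - (g (u1 x) - g (u2 x)))"
    have h': "(h has_real_derivative ?h) (at x)" unfolding h_def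
      using x by (auto intro!: derivative_eq_intros radial_sol_u[OF 1] radial_sol_u[OF 2]
          radial_sol_v[OF 1] radial_sol_v[OF 2] simp: algebra_simps diff_divide_distrib)
    have "((\<lambda>r. exp (- (1 + L) * r) * h r) has_real_derivative
        exp (- (1 + L) * x) * (?h - (1 + L) * h x)) (at x)"
      by (auto intro!: derivative_eq_intros h' simp: algebra_simps)
    moreover have "?h \<le> (1 + L) * h x"
    proof -
      show ?thesis unfolding h_def
        by (rule difference_energy_upper) (use lip[of "u1 x" "u2 x"] x L_pos in auto)
    qed
    then have "exp (- (1 + L) * x) * (?h - (1 + L) * h x) \<le> 0"
      by (intro mult_nonneg_nonpos) auto
    ultimately show "\<exists>y. ((\<lambda>r. exp (- (1 + L) * r) * h r) has_real_derivative y) (at x) \<and> y \<le> 0"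
      by blast
  qed
  then have "exp ((1 + L) * r) * (exp (- (1 + L) * r) * h r) \<le> exp ((1 + L) * r) * h 0"
    by (intro mult_left_mono) auto
  moreover have "exp ((1 + L) * r) * (exp (- (1 + L) * r) * h r) = h r"
    using exp_minus_inverse[of "(1 + L) * r"] by (simp only: mult_minus_left mult.assoc[symmetric])
  ultimately have "h r \<le> exp ((1 + L) * r) * h 0" by (simp only:)
  then show ?thesis
    using radial_sol_v0[OF 1] radial_sol_v0[OF 2] by (simp add: h_def)
qed

corollary continuous_dependence_abs:
  assumes "radial_sol N g u1 v1" "radial_sol N g u2 v2" "r \<ge> 0"
  shows "\<bar>u1 r - u2 r\<bar> \<le> exp ((1 + L) * r) * \<bar>u1 0 - u2 0\<bar>"
    and "\<bar>v1 r - v2 r\<bar> \<le> exp ((1 + L) * r) * \<bar>u1 0 - u2 0\<bar>"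
proof -
  have e: "1 \<le> exp ((1 + L) * r)" using assms(3) L_pos by simp
  have "(u1 r - u2 r)\<^sup>2 + (v1 r - v2 r)\<^sup>2 \<le> exp ((1 + L) * r) * (u1 0 - u2 0)\<^sup>2"
    by (rule continuous_dependence[OF assms])
  also have "\<dots> \<le> (exp ((1 + L) * r))\<^sup>2 * (u1 0 - u2 0)\<^sup>2"
    using self_le_power[OF e, of 2] by (intro mult_right_mono) auto
  also have "\<dots> = (exp ((1 + L) * r) * \<bar>u1 0 - u2 0\<bar>)\<^sup>2" by (simp add: power_mult_distrib)
  finally have le: "(u1 r - u2 r)\<^sup>2 + (v1 r - v2 r)\<^sup>2 \<le> (exp ((1 + L) * r) * \<bar>u1 0 - u2 0\<bar>)\<^sup>2" .
  have "\<bar>u1 r - u2 r\<bar>\<^sup>2 \<le> (exp ((1 + L) * r) * \<bar>u1 0 - u2 0\<bar>)\<^sup>2"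
    using le zero_le_power2[of "v1 r - v2 r"] unfolding power2_abs by linarith
  then show "\<bar>u1 r - u2 r\<bar> \<le> exp ((1 + L) * r) * \<bar>u1 0 - u2 0\<bar>"
    by (rule power2_le_imp_le) auto
  have "\<bar>v1 r - v2 r\<bar>\<^sup>2 \<le> (exp ((1 + L) * r) * \<bar>u1 0 - u2 0\<bar>)\<^sup>2"
    using le zero_le_power2[of "u1 r - u2 r"] unfolding power2_abs by linarith
  then show "\<bar>v1 r - v2 r\<bar> \<le> exp ((1 + L) * r) * \<bar>u1 0 - u2 0\<bar>"
    by (rule power2_le_imp_le) auto
qed

corollary radial_sol_unique:
  assumes "radial_sol N g u1 v1" "radial_sol N g u2 v2" "u1 0 = u2 0" "r \<ge> 0"
  shows "u1 r = u2 r"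
proof -
  have "(u1 r - u2 r)\<^sup>2 + (v1 r - v2 r)\<^sup>2 \<le> 0"
    using continuous_dependence[OF assms(1,2,4)] assms(3) by simp
  then show ?thesis by (simp add: sum_power2_le_zero_iff)
qed

text \<open>Going inwards the constant deteriorates as \<open>r\<close> tends to zero, so equality is first obtained
  on every \<open>{e..r0}\<close> with \<open>e > 0\<close> and then at \<open>0\<close> by continuity.\<close>

lemma radial_sol_unique_interior:
  assumes 1: "radial_sol N g u1 v1" and 2: "radial_sol N g u2 v2"
    and r0: "r0 > 0" and eq: "u1 r0 = u2 r0" "v1 r0 = v2 r0" and r: "r \<ge> 0"
  shows "u1 r = u2 r"
proof -
  define h where "h = (\<lambda>r. (u1 r - u2 r)\<^sup>2 + (v1 r - v2 r)\<^sup>2)"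
  have zero: "u1 e = u2 e" if e: "0 < e" "e \<le> r0" for e
  proof -
    define K where "K = 1 + L + 2 * real N / e"
    have "exp (K * e) * h e \<le> exp (K * r0) * h r0"
    proof (rule DERIV_nonneg_imp_increasing_open[OF e(2)])
      show "continuous_on {e..r0} (\<lambda>r. exp (K * r) * h r)"
        unfolding h_def using radial_sol_cont_u[OF 1] radial_sol_cont_u[OF 2]
          radial_sol_cont_v[OF 1] radial_sol_cont_v[OF 2] e
        by (intro continuous_intros) (auto intro: continuous_on_subset)
      fix x assume x: "e < x" "x < r0"
      then have x0: "x > 0" using e by simp
      let ?w = "u1 x - u2 x" and ?z = "v1 x - v2 x"
      let ?h = "2 * ?w * ?z + 2 * ?z * (- (real N / x) * ?z - (g (u1 x) - g (u2 x)))"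
      have h': "(h has_real_derivative ?h) (at x)" unfolding h_def
        using x0 by (auto intro!: derivative_eq_intros radial_sol_u[OF 1] radial_sol_u[OF 2]
            radial_sol_v[OF 1] radial_sol_v[OF 2] simp: algebra_simps diff_divide_distrib)
      have "((\<lambda>r. exp (K * r) * h r) has_real_derivative exp (K * x) * (?h + K * h x)) (at x)"
        by (auto intro!: derivative_eq_intros h' simp: algebra_simps)
      moreover have "?h + K * h x \<ge> 0"
      proof -
        have "- ((1 + L + 2 * (real N / x)) * h x) \<le> ?h" unfolding h_def
          by (rule difference_energy_lower) (use lip[of "u1 x" "u2 x"] x0 L_pos in auto)
        moreover have "(1 + L + 2 * (real N / x)) * h x \<le> K * h x"
        proof (rule mult_right_mono)
          have "real N / x \<le> real N / e" by (rule divide_left_mono) (use x e in auto)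
          then show "1 + L + 2 * (real N / x) \<le> K" by (simp add: K_def)
        qed (simp add: h_def)
        ultimately show ?thesis by linarith
      qed
      then have "exp (K * x) * (?h + K * h x) \<ge> 0" by (intro mult_nonneg_nonneg) auto
      ultimately show "\<exists>y. ((\<lambda>r. exp (K * r) * h r) has_real_derivative y) (at x) \<and> y \<ge> 0"
        by blast
    qed
    also have "h r0 = 0" using eq by (simp add: h_def)
    finally have "h e \<le> 0" by (simp add: mult_le_0_iff)
    then show ?thesis by (simp add: h_def sum_power2_le_zero_iff)
  qed
  have "u1 0 - u2 0 = 0"
  proof -
    have "eventually (\<lambda>x. 0 < x \<and> x < r0) (at_right (0::real))"
      using eventually_at_right_real[OF r0] by simp
    then have "eventually (\<lambda>x. u1 x - u2 x = 0) (at_right 0)"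
      by (rule eventually_mono) (simp add: zero)
    then have "((\<lambda>x. u1 x - u2 x) \<longlongrightarrow> 0) (at_right 0)"
      by (rule tendsto_eventually)
    moreover have "((\<lambda>x. u1 x - u2 x) \<longlongrightarrow> u1 0 - u2 0) (at_right 0)"
      by (intro tendsto_diff radial_sol_u_at_right_0[OF 1] radial_sol_u_at_right_0[OF 2])
    ultimately show ?thesis using tendsto_unique trivial_limit_at_right_real by blast
  qed
  then show ?thesis using radial_sol_unique[OF 1 2 _ r] by simp
qed

end

subsection \<open>Global existence\<close>

text \<open>The solution of \<open>(s\<^sup>N w)' = s\<^sup>N h\<close> vanishing at \<open>0\<close> is \<open>s\<close> times the weighted mean
  \<open>\<integral>\<^sub>0\<^sup>1 t\<^sup>N h (s t) dt\<close>, which is continuous up to \<open>s = 0\<close>.\<close>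

definition radial_mean :: "nat \<Rightarrow> (real \<Rightarrow> real) \<Rightarrow> real \<Rightarrow> real" where
  "radial_mean N h s = integral {0..1} (\<lambda>t. t ^ N * h (s * t))"

lemma radial_mean_integrable:
  assumes "continuous_on UNIV h"
  shows "(\<lambda>t. t ^ N * h (s * t)) integrable_on {0..1::real}"
  by (intro integrable_continuous_interval continuous_intros continuous_on_compose2[OF assms]) auto

lemma continuous_on_radial_mean:
  assumes "continuous_on UNIV h"
  shows "continuous_on S (radial_mean N h)"
proof -
  have "continuous_on (S \<times> cbox 0 (1::real)) (\<lambda>(s, t). t ^ N * h (s * t))"
    unfolding case_prod_beta
    by (intro continuous_intros continuous_on_compose2[OF assms]) auto
  from integral_continuous_on_param[OF this] show ?thesis
    by (simp add: radial_mean_def[abs_def])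
qed

lemma radial_mean_at_0: "radial_mean N h 0 = h 0 / (real N + 1)"
proof -
  have "((\<lambda>t::real. t ^ N) has_integral 1 ^ Suc N / real (Suc N) - 0 ^ Suc N / real (Suc N)) {0..1}"
    by (rule fundamental_theorem_of_calculus)
       (auto simp: has_real_derivative_iff_has_vector_derivative[symmetric]
         intro!: derivative_eq_intros simp del: power_Suc)
  then have "((\<lambda>t::real. t ^ N * h 0) has_integral (1 / (real N + 1)) * h 0) {0..1}"
    by (intro has_integral_mult_left) (simp add: add.commute)
  from integral_unique[OF this] show ?thesis
    unfolding radial_mean_def mult_zero_left by simp
qed

lemma radial_mean_bound:
  assumes h: "continuous_on UNIV h" and s: "s \<ge> 0"
    and B: "\<And>t. 0 \<le> t \<Longrightarrow> t \<le> s \<Longrightarrow> \<bar>h t\<bar> \<le> B"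
  shows "\<bar>radial_mean N h s\<bar> \<le> B"
proof -
  have "norm (radial_mean N h s) \<le> integral {0..1::real} (\<lambda>t. B)"
    unfolding radial_mean_def
  proof (rule integral_norm_bound_integral[OF radial_mean_integrable[OF h]])
    fix t :: real assume t: "t \<in> {0..1}"
    then have "\<bar>h (s * t)\<bar> \<le> B" using s by (intro B) (auto simp: mult_left_le)
    moreover have "t ^ N \<le> 1" using t by (simp add: power_le_one)
    ultimately have "t ^ N * \<bar>h (s * t)\<bar> \<le> 1 * B" using t by (intro mult_mono) auto
    then show "norm (t ^ N * h (s * t)) \<le> B" using t by (simp add: abs_mult)
  qed auto
  then show ?thesis by simp
qed

lemma radial_mean_diff:
  assumes "continuous_on UNIV h" "continuous_on UNIV k"
  shows "radial_mean N h s - radial_mean N k s = radial_mean N (\<lambda>t. h t - k t) s"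
  unfolding radial_mean_def
  by (subst integral_diff[symmetric])
     (auto intro: radial_mean_integrable assms simp: right_diff_distrib)

lemma radial_mean_flux:
  assumes h: "continuous_on UNIV h" and s: "s > 0"
  shows "s ^ Suc N * radial_mean N h s = integral {0..s} (\<lambda>t. t ^ N * h t)"
proof -
  have "((\<lambda>t. t ^ N * h t) has_integral integral {0..s} (\<lambda>t. t ^ N * h t)) {0..s}"
    by (intro integrable_integral integrable_continuous_interval continuous_intros
        continuous_on_subset[OF h]) auto
  from has_integral_stretch_real[OF this, of s] s
  have "((\<lambda>t. (s * t) ^ N * h (s * t)) has_integral
      (1 / s) * integral {0..s} (\<lambda>t. t ^ N * h t)) ((\<lambda>x. x / s) ` {0..s})" by simp
  moreover have "(\<lambda>x. x / s) ` {0..s} = {0..1}"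
    using s by (simp add: image_divide_atLeastAtMost)
  ultimately have "((\<lambda>t. s ^ N * (t ^ N * h (s * t))) has_integral
      (1 / s) * integral {0..s} (\<lambda>t. t ^ N * h t)) {0..1}"
    by (simp add: power_mult_distrib mult.assoc)
  from integral_unique[OF this] have "s ^ N * radial_mean N h s = (1 / s) * integral {0..s} (\<lambda>t. t ^ N * h t)"
    by (simp add: radial_mean_def)
  then show ?thesis using s by (simp add: field_simps)
qed

lemma radial_mean_deriv:
  assumes h: "continuous_on UNIV h" and s: "s \<ge> 0"
  shows "((\<lambda>s. s * radial_mean N h s) has_real_derivative
      h s - real N * radial_mean N h s) (at s within {0..})"
proof (cases "s = 0")
  case True
  have "continuous (at 0 within {0..}) (radial_mean N h)"
    using continuous_on_radial_mean[OF h, of "{0..}"] by (simp add: continuous_on_eq_continuous_within)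
  then have "(radial_mean N h \<longlongrightarrow> radial_mean N h 0) (at 0 within {0..})"
    by (simp add: continuous_within)
  moreover have "h 0 - real N * radial_mean N h 0 = radial_mean N h 0"
    by (simp add: radial_mean_at_0 field_simps)
  ultimately have "((\<lambda>y. (y * radial_mean N h y - 0 * radial_mean N h 0) / (y - 0)) \<longlongrightarrow>
      h 0 - real N * radial_mean N h 0) (at 0 within {0..})"
    by (auto elim!: Lim_transform_eventually simp: eventually_at_filter)
  then show ?thesis using True by (simp add: has_field_derivative_iff)
next
  case False
  then have s: "s > 0" using s by simp
  define I where "I = (\<lambda>s. integral {0..s} (\<lambda>t. t ^ N * h t))"
  have "(I has_real_derivative s ^ N * h s) (at s within {0..s+1})"
    unfolding I_def using s
    by (intro integral_has_real_derivative continuous_intros continuous_on_subset[OF h]) auto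
  moreover have "at s within {0..s+1} = at s" using s by (intro at_within_interior) auto
  ultimately have I: "(I has_real_derivative s ^ N * h s) (at s)" by simp
  have "((\<lambda>s. I s / s ^ N) has_real_derivative
      (s ^ N * h s * s ^ N - I s * (real N * s ^ (N - 1))) / (s ^ N * s ^ N)) (at s)"
    using s by (auto intro!: derivative_eq_intros I)
  moreover have "(s ^ N * h s * s ^ N - I s * (real N * s ^ (N - 1))) / (s ^ N * s ^ N)
      = h s - real N * radial_mean N h s"
  proof -
    have "I s = s ^ Suc N * radial_mean N h s"
      unfolding I_def radial_mean_flux[OF h s] ..
    then show ?thesis using s by (cases N) (auto simp: field_simps)
  qed
  ultimately have "((\<lambda>s. I s / s ^ N) has_real_derivative h s - real N * radial_mean N h s) (at s)"
    by simp
  then have "((\<lambda>s. s * radial_mean N h s) has_real_derivative h s - real N * radial_mean N h s) (at s)"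
  proof (rule has_field_derivative_transform_within_open[of _ _ _ "{0<..}"])
    fix x :: real assume "x \<in> {0<..}"
    then show "I x / x ^ N = x * radial_mean N h x"
      using radial_mean_flux[OF h, of x N] by (auto simp: I_def field_simps)
  qed (use s in auto)
  then show ?thesis by (rule has_field_derivative_at_within)
qed

context lipschitz_nonlinearity
begin

text \<open>The initial value problem is the fixed point equation
  \<open>u r = d - \<integral>\<^sub>0\<^sup>r s M(s) ds\<close>, where \<open>M\<close> is the radial mean of \<open>g \<circ> u\<close>.  The operator is a
  contraction by \<open>1/2\<close> for the norm with weight \<open>exp (- L r\<^sup>2)\<close>; the unknown of the fixed point
  theorem is the bounded function \<open>exp (- L r\<^sup>2) u r\<close>, extended to negative \<open>r\<close>.\<close>

definition weighted :: "(real \<Rightarrow>\<^sub>C real) \<Rightarrow> real \<Rightarrow> real" where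
  "weighted w r = exp (L * r\<^sup>2) * w r"

definition picard :: "nat \<Rightarrow> real \<Rightarrow> (real \<Rightarrow> real) \<Rightarrow> real \<Rightarrow> real" where
  "picard N d u r = d - integral {0..r} (\<lambda>s. s * radial_mean N (\<lambda>t. g (u t)) s)"

lemma continuous_weighted: "continuous_on S (weighted w)"
  unfolding weighted_def[abs_def] by (intro continuous_intros) auto

lemma continuous_g_comp: "continuous_on S u \<Longrightarrow> continuous_on S (\<lambda>t. g (u t))"
  by (rule continuous_on_compose2[OF continuous_g[of UNIV]]) auto

lemma picard_integrand_continuous:
  assumes "continuous_on UNIV u"
  shows "continuous_on S (\<lambda>s. s * radial_mean N (\<lambda>t. g (u t)) s)"
  by (intro continuous_intros continuous_on_radial_mean continuous_g_comp assms)

lemma picard_deriv: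
  assumes u: "continuous_on UNIV u" and r: "r \<ge> 0"
  shows "(picard N d u has_real_derivative - (r * radial_mean N (\<lambda>t. g (u t)) r)) (at r within {0..})"
proof -
  have "((\<lambda>r. integral {0..r} (\<lambda>s. s * radial_mean N (\<lambda>t. g (u t)) s)) has_real_derivative
      r * radial_mean N (\<lambda>t. g (u t)) r) (at r within {0..r+1})"
    using r by (intro integral_has_real_derivative picard_integrand_continuous u) auto
  moreover have "at r within {0..r+1} = at r within {0..}"
    by (rule at_within_nhd[of _ "{..<r+1}"]) auto
  ultimately have "((\<lambda>r. integral {0..r} (\<lambda>s. s * radial_mean N (\<lambda>t. g (u t)) s)) has_real_derivative
      r * radial_mean N (\<lambda>t. g (u t)) r) (at r within {0..})" by simp
  then show ?thesis unfolding picard_def[abs_def] by (auto intro!: derivative_eq_intros)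
qed

lemma picard_bounded:
  assumes B: "\<And>x. \<bar>g x\<bar> \<le> B" and u: "continuous_on UNIV u" and r: "r \<ge> 0"
  shows "\<bar>picard N d u r\<bar> \<le> \<bar>d\<bar> + B * r\<^sup>2"
proof -
  have "norm (integral {0..r} (\<lambda>s. s * radial_mean N (\<lambda>t. g (u t)) s)) \<le> integral {0..r} (\<lambda>s. r * B)"
  proof (rule integral_norm_bound_integral)
    fix s assume s: "s \<in> {0..r}"
    have "\<bar>radial_mean N (\<lambda>t. g (u t)) s\<bar> \<le> B"
      by (rule radial_mean_bound) (use s B continuous_g_comp[OF u] in auto)
    then have "\<bar>s\<bar> * \<bar>radial_mean N (\<lambda>t. g (u t)) s\<bar> \<le> r * B"
      using s by (intro mult_mono) auto
    then show "norm (s * radial_mean N (\<lambda>t. g (u t)) s) \<le> r * B" by (simp add: abs_mult)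
  qed (intro integrable_continuous_interval picard_integrand_continuous u continuous_intros)+
  also have "\<dots> = B * r\<^sup>2" using r by (simp add: power2_eq_square)
  finally show ?thesis unfolding picard_def by auto
qed

lemma picard_contraction:
  assumes u1: "continuous_on UNIV u1" and u2: "continuous_on UNIV u2" and r: "r \<ge> 0"
    and D: "\<And>t. t \<ge> 0 \<Longrightarrow> \<bar>u1 t - u2 t\<bar> \<le> D * exp (L * t\<^sup>2)"
  shows "\<bar>picard N d u1 r - picard N d u2 r\<bar> \<le> D / 2 * exp (L * r\<^sup>2)"
proof -
  let ?m1 = "radial_mean N (\<lambda>t. g (u1 t))" and ?m2 = "radial_mean N (\<lambda>t. g (u2 t))"
  have D0: "D \<ge> 0" using D[of 0] by auto
  have eq: "picard N d u1 r - picard N d u2 r = integral {0..r} (\<lambda>s. s * ?m2 s - s * ?m1 s)"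
    unfolding picard_def
    by (subst integral_diff)
       (auto intro!: integrable_continuous_interval picard_integrand_continuous u1 u2)
  have "((\<lambda>s. D * L * s * exp (L * s\<^sup>2)) has_integral
      D / 2 * exp (L * r\<^sup>2) - D / 2 * exp (L * 0\<^sup>2)) {0..r}"
    by (rule fundamental_theorem_of_calculus[OF r])
       (auto simp: has_real_derivative_iff_has_vector_derivative[symmetric]
         intro!: derivative_eq_intros)
  then have int: "(\<lambda>s. D * L * s * exp (L * s\<^sup>2)) integrable_on {0..r}"
    and val: "integral {0..r} (\<lambda>s. D * L * s * exp (L * s\<^sup>2)) = D / 2 * exp (L * r\<^sup>2) - D / 2"
    by (auto simp: has_integral_iff)
  have "norm (integral {0..r} (\<lambda>s. s * ?m2 s - s * ?m1 s)) \<le>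
      integral {0..r} (\<lambda>s. D * L * s * exp (L * s\<^sup>2))"
  proof (rule integral_norm_bound_integral[OF _ int])
    show "(\<lambda>s. s * ?m2 s - s * ?m1 s) integrable_on {0..r}"
      by (intro integrable_continuous_interval continuous_on_diff picard_integrand_continuous u1 u2)
    fix s assume s: "s \<in> {0..r}"
    have "\<bar>radial_mean N (\<lambda>t. g (u2 t) - g (u1 t)) s\<bar> \<le> L * (D * exp (L * s\<^sup>2))"
    proof (rule radial_mean_bound)
      show "continuous_on UNIV (\<lambda>t. g (u2 t) - g (u1 t))"
        by (intro continuous_on_diff continuous_g_comp u1 u2)
      fix t assume t: "0 \<le> t" "t \<le> s"
      have "\<bar>g (u2 t) - g (u1 t)\<bar> \<le> L * \<bar>u1 t - u2 t\<bar>"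
        using lip[of "u1 t" "u2 t"] by (simp add: abs_minus_commute)
      also have "\<dots> \<le> L * (D * exp (L * t\<^sup>2))" using L_pos D[OF t(1)] by simp
      also have "\<dots> \<le> L * (D * exp (L * s\<^sup>2))"
        using L_pos D0 t by (intro mult_left_mono) (auto intro!: power_mono)
      finally show "\<bar>g (u2 t) - g (u1 t)\<bar> \<le> L * (D * exp (L * s\<^sup>2))" .
    qed (use s in auto)
    then have "\<bar>s\<bar> * \<bar>?m2 s - ?m1 s\<bar> \<le> s * (L * (D * exp (L * s\<^sup>2)))"
      using s by (subst radial_mean_diff)
        (auto intro!: mult_mono continuous_g_comp u1 u2)
    moreover have "norm (s * ?m2 s - s * ?m1 s) = \<bar>s\<bar> * \<bar>?m2 s - ?m1 s\<bar>"
      by (simp add: abs_mult[symmetric] right_diff_distrib)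
    ultimately show "norm (s * ?m2 s - s * ?m1 s) \<le> D * L * s * exp (L * s\<^sup>2)"
      by (simp add: mult_ac)
  qed
  also have "\<dots> \<le> D / 2 * exp (L * r\<^sup>2)" using val D0 by simp
  finally show ?thesis unfolding eq by simp
qed

text \<open>Besides existence, the statement records that \<open>v\<close> is continuously differentiable up to
  \<open>r = 0\<close>.\<close>

theorem radial_sol_exists:
  assumes B: "\<And>x. \<bar>g x\<bar> \<le> B"
  obtains u v a where "radial_sol N g u v" "u 0 = d" "continuous_on {0..} a"
    "\<And>r. r \<ge> 0 \<Longrightarrow> (v has_real_derivative a r) (at r within {0..})"
proof -
  define T where "T = (\<lambda>w r. exp (- L * r\<^sup>2) * picard N d (weighted w) (max 0 r))"
  have B0: "B \<ge> 0" using B[of 0] by auto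
  have T_in: "T w \<in> bcontfun" for w
  proof -
    have pc: "continuous_on {0..} (picard N d (weighted w))"
      using picard_deriv[OF continuous_weighted] by (intro DERIV_continuous_on) auto
    have "continuous_on UNIV (T w)" unfolding T_def
      by (intro continuous_intros continuous_on_compose2[OF pc]) auto
    moreover have "norm (T w r) \<le> \<bar>d\<bar> + B / L" for r
    proof -
      have "\<bar>picard N d (weighted w) (max 0 r)\<bar> \<le> \<bar>d\<bar> + B * (max 0 r)\<^sup>2"
        by (intro picard_bounded B continuous_weighted) auto
      also have "(max 0 r)\<^sup>2 \<le> r\<^sup>2" by (auto simp: max_def)
      finally have "\<bar>picard N d (weighted w) (max 0 r)\<bar> \<le> \<bar>d\<bar> + B * r\<^sup>2"
        using B0 by (simp add: mult_left_mono)
      also have "\<dots> \<le> (\<bar>d\<bar> + B / L) * exp (L * r\<^sup>2)"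
      proof -
        have e: "L * r\<^sup>2 \<le> exp (L * r\<^sup>2)"
          using exp_ge_add_one_self[of "L * r\<^sup>2"] by linarith
        have "\<bar>d\<bar> * 1 \<le> \<bar>d\<bar> * exp (L * r\<^sup>2)"
          using L_pos by (intro mult_left_mono) auto
        moreover have "B / L * (L * r\<^sup>2) \<le> B / L * exp (L * r\<^sup>2)"
          by (rule mult_left_mono[OF e]) (use B0 L_pos in auto)
        ultimately show ?thesis using L_pos by (simp add: algebra_simps)
      qed
      finally have "exp (- L * r\<^sup>2) * \<bar>picard N d (weighted w) (max 0 r)\<bar> \<le>
          exp (- L * r\<^sup>2) * ((\<bar>d\<bar> + B / L) * exp (L * r\<^sup>2))"
        by (intro mult_left_mono) auto
      also have "\<dots> = \<bar>d\<bar> + B / L" by (simp add: exp_minus field_simps)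
      finally show ?thesis by (simp add: T_def abs_mult)
    qed
    then have "bounded (range (T w))" by (auto simp: bounded_iff)
    ultimately show ?thesis by (simp add: bcontfun_def)
  qed
  define \<Phi> where "\<Phi> w = Bcontfun (T w)" for w
  have \<Phi>: "apply_bcontfun (\<Phi> w) = T w" for w
    unfolding \<Phi>_def by (rule Bcontfun_inverse[OF T_in])
  have "\<exists>!w. \<Phi> w = w"
  proof (rule banach_fix_type)
    show "\<forall>w1 w2. dist (\<Phi> w1) (\<Phi> w2) \<le> 1/2 * dist w1 w2"
    proof (intro allI dist_bound)
      fix w1 w2 r
      have "\<bar>picard N d (weighted w1) (max 0 r) - picard N d (weighted w2) (max 0 r)\<bar>
          \<le> dist w1 w2 / 2 * exp (L * (max 0 r)\<^sup>2)"
      proof (rule picard_contraction[OF continuous_weighted continuous_weighted])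
        fix t :: real
        have "\<bar>w1 t - w2 t\<bar> \<le> dist w1 w2"
          using dist_bounded[of w1 t w2] by (simp add: dist_real_def)
        then have "\<bar>w1 t - w2 t\<bar> * exp (L * t\<^sup>2) \<le> dist w1 w2 * exp (L * t\<^sup>2)"
          by (intro mult_right_mono) auto
        then show "\<bar>weighted w1 t - weighted w2 t\<bar> \<le> dist w1 w2 * exp (L * t\<^sup>2)"
          by (simp add: weighted_def abs_mult mult.commute flip: left_diff_distrib)
      qed auto
      also have "\<dots> \<le> dist w1 w2 / 2 * exp (L * r\<^sup>2)"
        using L_pos by (intro mult_left_mono) (auto simp: max_def)
      finally have "exp (- L * r\<^sup>2) *
          \<bar>picard N d (weighted w1) (max 0 r) - picard N d (weighted w2) (max 0 r)\<bar>
          \<le> exp (- L * r\<^sup>2) * (dist w1 w2 / 2 * exp (L * r\<^sup>2))"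
        by (intro mult_left_mono) auto
      also have "\<dots> = 1/2 * dist w1 w2" by (simp add: exp_minus field_simps)
      finally show "dist (\<Phi> w1 r) (\<Phi> w2 r) \<le> 1/2 * dist w1 w2"
        by (simp add: \<Phi> T_def dist_real_def right_diff_distrib[symmetric] abs_mult)
    qed
  qed auto
  then obtain w where w: "\<Phi> w = w" by auto
  define u where "u = weighted w"
  define m where "m = radial_mean N (\<lambda>t. g (u t))"
  have cu: "continuous_on UNIV u" unfolding u_def by (rule continuous_weighted)
  have cg: "continuous_on UNIV (\<lambda>t. g (u t))" by (rule continuous_g_comp[OF cu])
  have fixpoint: "u r = picard N d u r" if "r \<ge> 0" for r
  proof -
    have "w r = exp (- L * r\<^sup>2) * picard N d u r"
      using \<Phi>[of w] that by (simp add: w T_def u_def max_def)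
    then have "u r = exp (L * r\<^sup>2) * (exp (- L * r\<^sup>2) * picard N d u r)"
      by (simp add: u_def weighted_def)
    then show ?thesis by (simp add: exp_minus)
  qed
  have u': "(u has_real_derivative - (r * m r)) (at r within {0..})" if "r \<ge> 0" for r
    by (rule has_field_derivative_transform_within[OF picard_deriv[OF cu that, of N d, folded m_def] zero_less_one])
       (use that fixpoint in auto)
  have v': "((\<lambda>r. - (r * m r)) has_real_derivative real N * m r - g (u r)) (at r within {0..})"
    if "r \<ge> 0" for r
    using DERIV_minus[OF radial_mean_deriv[OF cg that, of N]] by (simp add: m_def)
  have "radial_sol N g u (\<lambda>r. - (r * m r))"
    unfolding radial_sol_def
  proof (intro conjI allI impI)
    show "continuous_on {0..} (\<lambda>r. - (r * m r))"
      unfolding m_def by (intro continuous_intros continuous_on_radial_mean cg)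
    fix r :: real assume r: "r > 0"
    have "- (real N / r) * - (r * m r) - g (u r) = real N * m r - g (u r)" using r by simp
    then show "((\<lambda>r. - (r * m r)) has_real_derivative - (real N / r) * - (r * m r) - g (u r)) (at r)"
      using v'[of r] r within_Ici_eq_at[OF r] by simp
  qed (use u' in auto)
  moreover have "u 0 = d" using fixpoint[of 0] by (simp add: picard_def)
  moreover have "continuous_on {0..} (\<lambda>r. real N * m r - g (u r))"
    unfolding m_def using continuous_on_subset[OF cg, of "{0..}"]
    by (intro continuous_intros continuous_on_radial_mean cg) auto
  ultimately show ?thesis using v' that by blast
qed

end

section \<open>Existence of a ground state by shooting\<close>

text \<open>The structure of the nonlinearity that the argument uses.  \<open>F\<close> is the primitive of \<open>g\<close>,
  negative on \<open>{0<..<\<beta>}\<close> and positive at \<open>b\<close>; \<open>g\<close> is positive on \<open>{\<beta>..<b}\<close> and vanishes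
  outside \<open>{0..b}\<close>, which together with the Lipschitz condition makes it bounded.  On \<open>{0..\<delta>}\<close>, \<open>g\<close>
  is strictly decreasing and \<open>F\<close> is bounded above by a negative quadratic; these two assumptions
  govern the solutions near infinity.  The last assumption says that \<open>g x / (x - \<beta>)\<close> is nonincreasing on \<open>{\<beta><..<b}\<close>.\<close>

locale ground_state_nonlinearity = lipschitz_nonlinearity g L
  for g :: "real \<Rightarrow> real" and L :: real +
  fixes N :: nat and F :: "real \<Rightarrow> real" and \<beta> b \<delta> \<kappa> :: real
  assumes \<beta>: "0 < \<beta>" "\<beta> < b" and \<delta>: "0 < \<delta>" and \<kappa>: "0 < \<kappa>"
    and g_nonpos: "x \<le> 0 \<Longrightarrow> g x = 0" and g_top: "x \<ge> b \<Longrightarrow> g x = 0"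
    and F_deriv: "(F has_real_derivative g x) (at x)" and F_0: "F 0 = 0"
    and F_neg: "0 < x \<Longrightarrow> x < \<beta> \<Longrightarrow> F x < 0" and F_top: "F b > 0"
    and g_pos: "\<beta> \<le> x \<Longrightarrow> x < b \<Longrightarrow> g x > 0"
    and g_decreasing: "0 \<le> x \<Longrightarrow> x < y \<Longrightarrow> y \<le> \<delta> \<Longrightarrow> g y < g x"
    and F_quadratic: "0 \<le> x \<Longrightarrow> x \<le> \<delta> \<Longrightarrow> F x \<le> - (\<kappa>\<^sup>2 * x\<^sup>2 / 2)"
    and quotient_antimono: "\<beta> < x \<Longrightarrow> x \<le> y \<Longrightarrow> y < b \<Longrightarrow> g y * (x - \<beta>) \<le> g x * (y - \<beta>)"
begin

abbreviation sol :: "(real \<Rightarrow> real) \<Rightarrow> (real \<Rightarrow> real) \<Rightarrow> bool" where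
  "sol u v \<equiv> radial_sol N g u v"

text \<open>The energy of the one-dimensional motion; the term \<open>N / r\<close> acts as friction.\<close>

definition energy :: "(real \<Rightarrow> real) \<Rightarrow> (real \<Rightarrow> real) \<Rightarrow> real \<Rightarrow> real" where
  "energy u v r = (v r)\<^sup>2 / 2 + F (u r)"

lemma b_pos: "0 < b" using \<beta> by simp

lemma g_bound: "\<bar>g x\<bar> \<le> L * b"
proof (cases "0 \<le> x \<and> x \<le> b")
  case True
  then have "\<bar>g x - g 0\<bar> \<le> L * \<bar>x - 0\<bar>" by (intro lip)
  also have "\<dots> \<le> L * b" using True L_pos by (intro mult_left_mono) auto
  finally show ?thesis using g_nonpos[of 0] by simp
next
  case False
  then show ?thesis using g_nonpos[of x] g_top[of x] L_pos b_pos by auto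
qed

lemma F_isCont: "isCont F x" using F_deriv by (rule DERIV_isCont)

lemma F_continuous_on: "continuous_on S F"
  by (intro continuous_at_imp_continuous_on ballI F_isCont)

lemma F_bounded:
  obtains C where "C > 0" "\<And>x. 0 \<le> x \<Longrightarrow> x \<le> b \<Longrightarrow> \<bar>F x\<bar> \<le> C"
proof -
  have "bounded (F ` {0..b})"
    by (intro compact_imp_bounded compact_continuous_image F_continuous_on) simp
  then obtain C where C: "C > 0" "\<forall>y\<in>F ` {0..b}. norm y \<le> C"
    unfolding bounded_pos by blast
  show ?thesis
  proof (rule that[OF C(1)])
    fix x assume "0 \<le> x" "x \<le> b"
    then show "\<bar>F x\<bar> \<le> C" using C(2) by simp
  qed
qed

lemma nonneg_F_cases:
  assumes "F x \<ge> 0" "x \<ge> 0"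
  shows "x = 0 \<or> \<beta> \<le> x"
  using assms F_neg[of x] by (cases "x = 0"; cases "x < \<beta>") auto

lemma energy_0: "sol u v \<Longrightarrow> energy u v 0 = F (u 0)"
  by (simp add: energy_def radial_sol_v0)

lemma energy_deriv:
  assumes "sol u v" "r > 0"
  shows "(energy u v has_real_derivative - (real N / r) * (v r)\<^sup>2) (at r)"
proof -
  have Fu: "((\<lambda>r. F (u r)) has_real_derivative g (u r) * v r) (at r)"
    by (rule DERIV_chain2[OF F_deriv radial_sol_u[OF assms]])
  have "((\<lambda>r. (v r)\<^sup>2 / 2 + F (u r)) has_real_derivative
      v r * (- (real N / r) * v r - g (u r)) + g (u r) * v r) (at r)"
    by (auto intro!: derivative_eq_intros Fu radial_sol_v[OF assms])
  moreover have "v r * (- (real N / r) * v r - g (u r)) + g (u r) * v r = - (real N / r) * (v r)\<^sup>2"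
    by (simp add: power2_eq_square algebra_simps)
  ultimately show ?thesis unfolding energy_def[abs_def] by simp
qed

lemma energy_cont:
  assumes "sol u v"
  shows "continuous_on {0..} (energy u v)"
  unfolding energy_def[abs_def]
  by (intro continuous_intros radial_sol_cont_v[OF assms]
      continuous_on_compose2[OF F_continuous_on radial_sol_cont_u[OF assms]]) auto

lemma energy_antimono:
  assumes "sol u v" "0 \<le> r" "r \<le> s"
  shows "energy u v s \<le> energy u v r"
proof (rule DERIV_nonpos_imp_decreasing_open[OF assms(3)])
  fix x assume "r < x" "x < s"
  then have "(energy u v has_real_derivative - (real N / x) * (v x)\<^sup>2) (at x)"
    and "- (real N / x) * (v x)\<^sup>2 \<le> 0"
    using energy_deriv[OF assms(1), of x] assms(2) by auto
  then show "\<exists>y. (energy u v has_real_derivative y) (at x) \<and> y \<le> 0" by blast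
next
  show "continuous_on {r..s} (energy u v)"
    using energy_cont[OF assms(1)] by (rule continuous_on_subset) (use assms(2) in auto)
qed

text \<open>The energy is monotone, hence convergent, so \<open>v\<^sup>2\<close> converges along with \<open>u\<close>; its limit is
  zero because \<open>u\<close> is bounded, and then the equation forces \<open>g l = 0\<close>.\<close>

lemma limits_at_infinity:
  assumes s: "sol u v" and range: "\<And>r. r \<ge> 0 \<Longrightarrow> 0 \<le> u r \<and> u r \<le> b"
    and u: "(u \<longlongrightarrow> l) at_top"
  shows "(v \<longlongrightarrow> 0) at_top" "(energy u v \<longlongrightarrow> F l) at_top" "g l = 0"
    and "\<And>r. r \<ge> 0 \<Longrightarrow> F l \<le> energy u v r"
proof -
  obtain C where C: "\<And>x. 0 \<le> x \<Longrightarrow> x \<le> b \<Longrightarrow> \<bar>F x\<bar> \<le> C" using F_bounded by blast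
  have "- C \<le> energy u v r" if "r \<ge> 0" for r
    using C[of "u r"] range[OF that] by (auto simp: energy_def intro: add_increasing)
  then obtain e where e: "(energy u v \<longlongrightarrow> e) at_top" "\<And>r. r \<ge> 0 \<Longrightarrow> e \<le> energy u v r"
    using antimono_bounded_tendsto_at_top[of "energy u v" "- C"] energy_antimono[OF s] by metis
  have Fu: "((\<lambda>r. F (u r)) \<longlongrightarrow> F l) at_top"
    by (rule isCont_tendsto_compose[OF F_isCont u])
  have "((\<lambda>r. 2 * (energy u v r - F (u r))) \<longlongrightarrow> 2 * (e - F l)) at_top"
    by (intro tendsto_intros e Fu)
  then have v2: "((\<lambda>r. (v r)\<^sup>2) \<longlongrightarrow> 2 * (e - F l)) at_top" by (simp add: energy_def)
  have "2 * (e - F l) = 0\<^sup>2"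
    by (rule limit_of_derivative_zero[where \<phi> = "\<lambda>x. x\<^sup>2", OF radial_sol_u[OF s] u v2])
       (auto intro!: continuous_intros)
  then have el: "e = F l" by simp
  with v2 have "((\<lambda>r. sqrt ((v r)\<^sup>2)) \<longlongrightarrow> sqrt 0) at_top" by (intro tendsto_real_sqrt) simp
  then show v: "(v \<longlongrightarrow> 0) at_top" by (simp add: tendsto_rabs_zero_iff)
  show "(energy u v \<longlongrightarrow> F l) at_top" "\<And>r. r \<ge> 0 \<Longrightarrow> F l \<le> energy u v r" using e el by auto
  have gl: "((\<lambda>r. g (u r)) \<longlongrightarrow> g l) at_top"
    by (rule isCont_tendsto_compose[OF _ u])
       (use continuous_g[of UNIV] in \<open>simp add: continuous_on_eq_continuous_at\<close>)
  have N: "((\<lambda>r. real N / r) \<longlongrightarrow> 0) at_top"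
    by (rule tendsto_divide_0[OF tendsto_const]) (simp add: filterlim_at_top_imp_at_infinity filterlim_ident)
  have "((\<lambda>r. - (real N / r) * v r - g (u r)) \<longlongrightarrow> - 0 * 0 - g l) at_top"
    by (intro tendsto_intros N v gl)
  from limit_of_derivative_zero[where \<phi> = "\<lambda>x. x", OF radial_sol_v[OF s] v this continuous_ident]
  show "g l = 0" by simp
qed

lemma positive_of_nonneg:
  assumes s: "sol u v" and nonneg: "\<And>r. r \<ge> 0 \<Longrightarrow> u r \<ge> 0" and "u 0 > 0" and r: "r \<ge> 0"
  shows "u r > 0"
proof (rule ccontr)
  assume "\<not> u r > 0"
  then have 0: "u r = 0" using nonneg[OF r] by simp
  then have "r > 0" using r \<open>u 0 > 0\<close> by (cases "r = 0") auto
  have "v r = 0"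
    by (rule DERIV_local_min[OF radial_sol_u[OF s \<open>r > 0\<close>] \<open>r > 0\<close>]) (use nonneg 0 in auto)
  then have "u 0 = 0"
    using radial_sol_unique_interior[OF s radial_sol_const[of g 0] \<open>r > 0\<close>, of 0] 0 g_nonpos by simp
  then show False using \<open>u 0 > 0\<close> by simp
qed

text \<open>At a first critical point \<open>r > 0\<close> the energy is \<open>F (u r)\<close>.  If it is nonnegative, then
  \<open>u r = 0\<close>, excluded by uniqueness, or \<open>\<beta> \<le> u r < b\<close>; in the latter case \<open>g (u r) > 0\<close> and \<open>r\<close>
  would be a strict local maximum, although \<open>u\<close> decreases up to \<open>r\<close>.\<close>

lemma strictly_decreasing:
  assumes s: "sol u v" and nonneg: "\<And>r. r \<ge> 0 \<Longrightarrow> u r \<ge> 0" and u0: "0 < u 0" "u 0 < b"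
    and en: "\<And>r. r \<ge> 0 \<Longrightarrow> (\<And>s. 0 < s \<Longrightarrow> s < r \<Longrightarrow> v s < 0) \<Longrightarrow> energy u v r \<ge> 0"
    and r: "r > 0"
  shows "v r < 0"
proof (rule ccontr)
  assume nv: "\<not> v r < 0"
  have "F (u 0) \<ge> 0" using en[of 0] energy_0[OF s] by simp
  then have "\<beta> \<le> u 0" using nonneg_F_cases[of "u 0"] u0 by auto
  then have "g (u 0) > 0" using g_pos u0 by simp
  moreover have "((\<lambda>r. g (u r)) \<longlongrightarrow> g (u 0)) (at_right 0)"
    using continuous_g_comp[OF radial_sol_cont_u[OF s]] by (rule continuous_on_Ici_at_right)
  ultimately have "eventually (\<lambda>r. g (u r) > 0) (at_right 0)" by (rule order_tendstoD(1)[rotated])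
  then obtain \<epsilon> where \<epsilon>: "\<epsilon> > 0" "\<And>r. 0 < r \<Longrightarrow> r < \<epsilon> \<Longrightarrow> g (u r) > 0"
    by (auto simp: eventually_at_right_field)
  have near: "v r < 0" if r: "0 < r" "r < \<epsilon>" for r
  proof -
    have "r ^ N * v r < 0 ^ N * v 0"
    proof (rule DERIV_neg_imp_decreasing_open[OF r(1), where f = "\<lambda>r. r ^ N * v r"])
      show "continuous_on {0..r} (\<lambda>r. r ^ N * v r)"
        by (intro continuous_intros continuous_on_subset[OF radial_sol_cont_v[OF s]]) auto
      fix x assume "0 < x" "x < r"
      then show "\<exists>y. ((\<lambda>r. r ^ N * v r) has_real_derivative y) (at x) \<and> y < 0"
        using radial_sol_flux[OF s, of x] \<epsilon>(2)[of x] r by (intro exI conjI) auto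
    qed
    then show ?thesis using r radial_sol_v0[OF s] by (auto simp: mult_less_0_iff zero_less_power not_less)
  qed
  define a where "a = min \<epsilon> r / 2"
  have a: "0 < a" "a < \<epsilon>" "a < r" using \<epsilon>(1) r by (auto simp: a_def min_def)
  obtain z where z: "a < z" "z \<le> r" "v z = 0" "\<And>x. a \<le> x \<Longrightarrow> x < z \<Longrightarrow> v x < 0"
    using first_zero[OF a(3), of v] continuous_on_subset[OF radial_sol_cont_v[OF s], of "{a..r}"]
      near[OF a(1,2)] nv a by auto
  have neg: "v x < 0" if "0 < x" "x < z" for x
    using near[of x] z(4)[of x] that a by (cases "x < a") auto
  have z0: "z > 0" using z a by simp
  have "u z < u 0"
  proof (rule DERIV_neg_imp_decreasing_open[OF z0])
    show "continuous_on {0..z} u" using radial_sol_cont_u[OF s] by (rule continuous_on_subset) auto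
    fix x assume "0 < x" "x < z"
    then show "\<exists>y. (u has_real_derivative y) (at x) \<and> y < 0"
      using neg radial_sol_u[OF s] by blast
  qed
  have "energy u v z \<ge> 0" using en[of z] neg z0 by simp
  then have "F (u z) \<ge> 0" using z by (simp add: energy_def)
  then consider "u z = 0" | "\<beta> \<le> u z" using nonneg_F_cases[of "u z"] nonneg[of z] z0 by auto
  then show False
  proof cases
    case 1
    then have "u 0 = 0"
      using radial_sol_unique_interior[OF s radial_sol_const[of g 0] z0, of 0] g_nonpos z by simp
    then show False using u0 by simp
  next
    case 2
    then have "g (u z) > 0" using g_pos \<open>u z < u 0\<close> u0 by simp
    then have "- (real N / z) * v z - g (u z) < 0" using z by simp
    from DERIV_neg_dec_left[OF radial_sol_v[OF s z0] this]
    obtain d where d: "d > 0" "\<And>h. h > 0 \<Longrightarrow> h < d \<Longrightarrow> v z < v (z - h)" by auto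
    define h where "h = min d z / 2"
    have "h > 0" "h < d" "h < z" using d(1) z0 by (auto simp: h_def min_def)
    then show False using d(2)[of h] neg[of "z - h"] z by simp
  qed
qed

text \<open>Decaying solutions with values in \<open>{0<..<b}\<close>, the range in which \<open>g\<close> is later the given
  nonlinearity.\<close>

definition ground_state :: "(real \<Rightarrow> real) \<Rightarrow> (real \<Rightarrow> real) \<Rightarrow> bool" where
  "ground_state u v \<longleftrightarrow> sol u v \<and> (\<forall>r\<ge>0. 0 < u r \<and> u r < b) \<and> (u \<longlongrightarrow> 0) at_top"

lemma decreasing_of_neg:
  assumes s: "sol u v" and neg: "\<And>r. r > 0 \<Longrightarrow> v r < 0" and r: "0 \<le> r" "r < t"
  shows "u t < u r"
proof (rule DERIV_neg_imp_decreasing_open[OF r(2)])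
  show "continuous_on {r..t} u"
    using radial_sol_cont_u[OF s] by (rule continuous_on_subset) (use r in auto)
  fix x assume "r < x" "x < t"
  then show "\<exists>y. (u has_real_derivative y) (at x) \<and> y < 0"
    using neg[of x] radial_sol_u[OF s, of x] r by auto
qed

text \<open>The limit \<open>l\<close> of \<open>u\<close> is a zero of \<open>g\<close> with \<open>F l \<ge> 0\<close> and \<open>0 \<le> l < b\<close>, hence \<open>l = 0\<close>.\<close>

lemma ground_state_of_nonneg:
  assumes s: "sol u v" and nonneg: "\<And>r. r \<ge> 0 \<Longrightarrow> u r \<ge> 0" and u0: "0 < u 0" "u 0 < b"
    and en: "\<And>r. r \<ge> 0 \<Longrightarrow> energy u v r \<ge> 0"
  shows "ground_state u v"
proof -
  have neg: "v r < 0" if "r > 0" for r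
    using strictly_decreasing[OF s nonneg u0 _ that] en by blast
  note decr = decreasing_of_neg[OF s neg]
  have mono: "u t \<le> u r" if "0 \<le> r" "r \<le> t" for r t
    using decr[of r t] that by (cases "r = t") auto
  obtain l where l: "(u \<longlongrightarrow> l) at_top" "\<And>r. r \<ge> 0 \<Longrightarrow> l \<le> u r" "0 \<le> l"
    using antimono_bounded_tendsto_at_top[of u 0] mono nonneg by metis
  have range: "0 \<le> u r \<and> u r \<le> b" if "r \<ge> 0" for r
    using mono[of 0 r] that u0 nonneg by auto
  note lim = limits_at_infinity[OF s range l(1)]
  have "F l \<ge> 0" using lim(2) by (rule tendsto_lowerbound) (auto intro!: eventually_at_top_linorderI[of 0] en)
  moreover have "l < b" using l(2)[of 0] u0 by simp
  ultimately have "l = 0" using nonneg_F_cases[of l] l(3) g_pos[of l] lim(3) by auto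
  moreover have "u r < b" if "r \<ge> 0" for r using mono[of 0 r] that u0 by simp
  ultimately show ?thesis
    using s l(1) positive_of_nonneg[OF s nonneg u0(1)] by (auto simp: ground_state_def)
qed

text \<open>Started close to the equilibrium \<open>b\<close>, the solution stays near \<open>b\<close> until the friction
  \<open>N / r\<close> is small; from then on it loses at most \<open>N M b / R\<close> of its energy while decreasing,
  where \<open>M\<close> bounds its slope.  Its energy thus stays away from zero, which a nonnegative
  solution cannot afford.\<close>

lemma crossing_solution:
  obtains d where "0 < d" "d < b" "\<And>u v. sol u v \<Longrightarrow> u 0 = d \<Longrightarrow> \<exists>r\<ge>0. u r < 0"
proof -
  obtain C where C: "C > 0" "\<And>x. 0 \<le> x \<Longrightarrow> x \<le> b \<Longrightarrow> \<bar>F x\<bar> \<le> C" using F_bounded by blast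
  define M where "M = 2 * sqrt C"
  have M: "M > 0" "M\<^sup>2 = 4 * C" using C by (auto simp: M_def power_mult_distrib)
  define K where "K = F b"
  have K: "K > 0" using F_top by (simp add: K_def)
  define R where "R = 1 + 4 * real N * M * b / K"
  have R: "R > 0" "real N * M * b / R \<le> K / 4"
  proof -
    have "4 * real N * M * b / K \<ge> 0" using M K b_pos by simp
    then show R0: "R > 0" by (simp add: R_def)
    have "4 * (real N * M * b) = (R - 1) * K" using K by (simp add: R_def)
    also have "\<dots> \<le> K * R" using K by (simp add: algebra_simps)
    finally show "real N * M * b / R \<le> K / 4" using R0 by (simp add: field_simps)
  qed
  have "\<exists>\<eta>>0. \<forall>x. \<bar>x - b\<bar> < \<eta> \<longrightarrow> \<bar>F x - F b\<bar> < K / 2"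
    using F_isCont[of b] half_gt_zero[OF K] unfolding continuous_at_eps_delta dist_real_def by blast
  then obtain \<eta> where \<eta>: "\<eta> > 0" "\<And>x. \<bar>x - b\<bar> < \<eta> \<Longrightarrow> \<bar>F x - F b\<bar> < K / 2"
    by blast
  \<comment> \<open>By continuous dependence this keeps the solution within \<open>\<eta> / 2\<close> of \<open>b\<close> on \<open>{0..R}\<close>.\<close>
  define d where "d = b - min \<eta> b / 2 * exp (- ((1 + L) * R))"
  have m: "min \<eta> b > 0" using \<eta>(1) b_pos by simp
  have "exp (- ((1 + L) * R)) \<le> 1" using R L_pos by simp
  then have "min \<eta> b / 2 * exp (- ((1 + L) * R)) \<le> min \<eta> b / 2 * 1"
    using m by (intro mult_left_mono) auto
  also have "\<dots> < b" using m by (auto simp: min_def)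
  finally have d: "0 < d" "d < b" using m by (auto simp: d_def)
  show ?thesis
  proof (rule that[OF d], rule ccontr)
    fix u v assume s: "sol u v" and ud: "u 0 = d" and no: "\<not> (\<exists>r\<ge>0. u r < 0)"
    then have nonneg: "u r \<ge> 0" if "r \<ge> 0" for r using no that not_less by blast
    have close: "F (u r) > K / 2" if r: "0 \<le> r" "r \<le> R" for r
    proof -
      have "\<bar>u r - b\<bar> \<le> exp ((1 + L) * r) * \<bar>d - b\<bar>"
        using continuous_dependence_abs(1)[OF s radial_sol_const[of g b N] r(1)] g_top[of b] ud by simp
      also have "\<dots> \<le> exp ((1 + L) * R) * \<bar>d - b\<bar>"
        using r L_pos by (intro mult_right_mono) auto
      also have "\<bar>d - b\<bar> = min \<eta> b / 2 * exp (- ((1 + L) * R))" using m by (simp add: d_def)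
      also have "exp ((1 + L) * R) * (min \<eta> b / 2 * exp (- ((1 + L) * R))) = min \<eta> b / 2"
        by (simp add: exp_minus)
      also have "\<dots> < \<eta>" using m by (auto simp: min_def)
      finally have "\<bar>F (u r) - F b\<bar> < K / 2" by (rule \<eta>(2))
      then show ?thesis unfolding K_def by linarith
    qed
    have en: "energy u v r \<ge> K / 4"
      if r: "r \<ge> 0" and neg: "\<And>s. 0 < s \<Longrightarrow> s < r \<Longrightarrow> v s < 0" for r
    proof (cases "r \<le> R")
      case True
      then have "F (u r) > K / 2" using close r by simp
      then have "energy u v r > K / 2" by (simp add: energy_def add_strict_increasing2)
      then show ?thesis using K by simp
    next
      case False
      have decr: "u t < u 0" if "0 < t" "t < r" for t
      proof (rule DERIV_neg_imp_decreasing_open[OF that(1)])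
        show "continuous_on {0..t} u" using radial_sol_cont_u[OF s] by (rule continuous_on_subset) auto
        fix x assume "0 < x" "x < t"
        then show "\<exists>y. (u has_real_derivative y) (at x) \<and> y < 0"
          using neg[of x] radial_sol_u[OF s, of x] that by auto
      qed
      have slope: "- v t \<le> M" if "0 < t" "t < r" for t
      proof -
        have "energy u v t \<le> F d" using energy_antimono[OF s, of 0 t] energy_0[OF s] ud that by simp
        moreover have "F d \<le> C" using C(2)[of d] d by simp
        moreover have "- C \<le> F (u t)" using C(2)[of "u t"] nonneg[of t] decr[OF that] ud d that by simp
        ultimately have "(- v t)\<^sup>2 \<le> M\<^sup>2" unfolding M(2) by (simp add: energy_def)
        then show ?thesis by (rule power2_le_imp_le) (use M(1) in simp)
      qed
      \<comment> \<open>Beyond \<open>R\<close> the energy lost is at most \<open>c\<close> times the drop of \<open>u\<close>.\<close>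
      define c where "c = real N * M / R"
      have "energy u v R - c * u R \<le> energy u v r - c * u r"
      proof (rule DERIV_nonneg_imp_increasing_open[where f = "\<lambda>r. energy u v r - c * u r"])
        show "continuous_on {R..r} (\<lambda>r. energy u v r - c * u r)"
          by (intro continuous_intros continuous_on_subset[OF energy_cont[OF s]]
              continuous_on_subset[OF radial_sol_cont_u[OF s]]) (use R in auto)
        fix x assume x: "R < x" "x < r"
        then have x0: "x > 0" using R by simp
        have "((\<lambda>r. energy u v r - c * u r) has_real_derivative
            - (real N / x) * (v x)\<^sup>2 - c * v x) (at x)"
          by (auto intro!: derivative_eq_intros energy_deriv[OF s x0] radial_sol_u[OF s x0])
        moreover have "- (real N / x) * (v x)\<^sup>2 - c * v x \<ge> 0"
        proof -
          have "(- v x) / x \<le> M / R"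
            using slope[of x] x x0 R M neg[of x] by (intro frac_le) auto
          then have "real N * (- v x) * ((- v x) / x) \<le> real N * (- v x) * (M / R)"
            using neg[of x] x x0 by (intro mult_left_mono mult_nonneg_nonneg) auto
          then show ?thesis by (simp add: c_def power2_eq_square algebra_simps)
        qed
        ultimately show "\<exists>y. ((\<lambda>r. energy u v r - c * u r) has_real_derivative y) (at x) \<and> y \<ge> 0"
          by blast
      qed (use False in simp)
      moreover have "energy u v R > K / 2"
        using close[of R] R by (simp add: energy_def add_strict_increasing2)
      moreover have "c * u R \<le> c * b"
        using decr[of R] False R ud d M by (intro mult_left_mono) (auto simp: c_def)
      moreover have "c * u r \<ge> 0" using nonneg[OF r] M R by (simp add: c_def)
      moreover have "c * b \<le> K / 4" using R by (simp add: c_def)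
      ultimately show ?thesis by linarith
    qed
    have en0: "energy u v r \<ge> 0"
      if "r \<ge> 0" "\<And>s. 0 < s \<Longrightarrow> s < r \<Longrightarrow> v s < 0" for r
      using en[OF that] K by linarith
    have u0: "0 < u 0" "u 0 < b" using ud d by auto
    note neg = strictly_decreasing[OF s nonneg u0 en0]
    have en': "energy u v r \<ge> K / 4" if "r \<ge> 0" for r by (rule en[OF that neg])
    have "ground_state u v"
      by (rule ground_state_of_nonneg[OF s nonneg u0 en0[OF _ neg]])
    then have gs: "\<And>r. r \<ge> 0 \<Longrightarrow> 0 \<le> u r \<and> u r \<le> b" "(u \<longlongrightarrow> 0) at_top"
      by (auto simp: ground_state_def less_imp_le)
    have "(energy u v \<longlongrightarrow> F 0) at_top"
      by (rule limits_at_infinity(2)[OF s gs])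
    then have "F 0 \<ge> K / 4"
      by (rule tendsto_lowerbound) (rule eventually_at_top_linorderI[of 0], erule en', simp)
    then show False using F_0 K by simp
  qed
qed

text \<open>Shooting: the initial values whose solution loses too much energy to reach zero, and those
  whose solution crosses zero, form disjoint nonempty open sets, so they do not exhaust the
  interval \<open>{0<..<b}\<close>.\<close>

theorem ground_state_exists:
  obtains u v a where "ground_state u v" "continuous_on {0..} a"
    "\<And>r. r \<ge> 0 \<Longrightarrow> (v has_real_derivative a r) (at r within {0..})"
proof -
  have "\<forall>d. \<exists>u v a. sol u v \<and> u 0 = d \<and> continuous_on {0..} a \<and>
      (\<forall>r\<ge>0. (v has_real_derivative a r) (at r within {0..}))"
  proof
    fix d
    show "\<exists>u v a. sol u v \<and> u 0 = d \<and> continuous_on {0..} a \<and>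
      (\<forall>r\<ge>0. (v has_real_derivative a r) (at r within {0..}))"
      by (rule radial_sol_exists[OF g_bound, of N d]) blast
  qed
  then obtain U V A where UV: "\<And>d. sol (U d) (V d)" "\<And>d. U d 0 = d"
    and A: "\<And>d. continuous_on {0..} (A d)"
      "\<And>d r. r \<ge> 0 \<Longrightarrow> (V d has_real_derivative A d r) (at r within {0..})"
    by metis
  have dep: "\<bar>U d r - U e r\<bar> \<le> exp ((1 + L) * r) * \<bar>d - e\<bar>"
    "\<bar>V d r - V e r\<bar> \<le> exp ((1 + L) * r) * \<bar>d - e\<bar>" if "r \<ge> 0" for d e r
    using continuous_dependence_abs[OF UV(1)[of d] UV(1)[of e] that] UV(2) by auto
  have contU: "continuous_on UNIV (\<lambda>d. U d r)" and contV: "continuous_on UNIV (\<lambda>d. V d r)"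
    if "r \<ge> 0" for r
  proof -
    have "(exp ((1 + L) * r))-lipschitz_on UNIV (\<lambda>d. U d r)"
      "(exp ((1 + L) * r))-lipschitz_on UNIV (\<lambda>d. V d r)"
      using dep[OF that] by (auto intro!: lipschitz_onI simp: dist_real_def)
    then show "continuous_on UNIV (\<lambda>d. U d r)" "continuous_on UNIV (\<lambda>d. V d r)"
      by (auto intro: lipschitz_on_continuous_on)
  qed
  define Ineg where "Ineg = {d. \<exists>r\<ge>0. U d r < 0}"
  define Ipos where "Ipos = {d. \<exists>r\<ge>0. energy (U d) (V d) r < 0 \<and> (\<forall>s\<in>{0..r}. U d s > 0)}"
  have "open Ineg"
  proof -
    have "Ineg = (\<Union>r\<in>{0..}. {d. U d r < 0})" by (auto simp: Ineg_def)
    moreover have "open {d. U d r < 0}" if "r \<ge> 0" for r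
      by (intro open_Collect_less contU[OF that] continuous_on_const)
    ultimately show ?thesis by auto
  qed
  moreover have "open Ipos"
  proof (rule openI)
    fix d assume "d \<in> Ipos"
    then obtain r where r: "r \<ge> 0" "energy (U d) (V d) r < 0" "\<And>s. s \<in> {0..r} \<Longrightarrow> U d s > 0"
      by (auto simp: Ipos_def)
    have "continuous_on {0..r} (U d)"
      using radial_sol_cont_u[OF UV(1)] by (rule continuous_on_subset) auto
    from continuous_attains_inf[OF _ _ this] r(1)
    obtain s0 where s0: "s0 \<in> {0..r}" "\<And>s. s \<in> {0..r} \<Longrightarrow> U d s0 \<le> U d s" by auto
    define m where "m = U d s0"
    have m: "m > 0" using r(3)[OF s0(1)] by (simp add: m_def)
    have "open {e. energy (U e) (V e) r < 0}" unfolding energy_def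
      by (intro open_Collect_less continuous_intros contV[OF r(1)]
          continuous_on_compose2[OF F_continuous_on[of UNIV] contU[OF r(1)]]) auto
    with r(2) obtain \<epsilon> where \<epsilon>: "\<epsilon> > 0" "\<And>e. e \<in> ball d \<epsilon> \<Longrightarrow> energy (U e) (V e) r < 0"
      by (force elim: openE)
    define \<epsilon>' where "\<epsilon>' = min \<epsilon> (m / exp ((1 + L) * r))"
    have "ball d \<epsilon>' \<subseteq> Ipos"
    proof
      fix e assume e: "e \<in> ball d \<epsilon>'"
      have "U e s > 0" if s: "s \<in> {0..r}" for s
      proof -
        have "\<bar>U d s - U e s\<bar> \<le> exp ((1 + L) * s) * \<bar>d - e\<bar>" using s by (intro dep) auto
        also have "\<dots> \<le> exp ((1 + L) * r) * \<bar>d - e\<bar>"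
          using s L_pos by (intro mult_right_mono) auto
        also have "\<dots> < m" using e by (simp add: \<epsilon>'_def dist_real_def field_simps)
        also have "m \<le> U d s" unfolding m_def by (rule s0(2)[OF s])
        finally show ?thesis by linarith
      qed
      moreover have "energy (U e) (V e) r < 0" using e by (intro \<epsilon>) (simp add: \<epsilon>'_def)
      ultimately show "e \<in> Ipos" using r(1) by (auto simp: Ipos_def)
    qed
    moreover have "\<epsilon>' > 0" using \<epsilon> m by (simp add: \<epsilon>'_def)
    ultimately show "\<exists>T>0. ball d T \<subseteq> Ipos" by blast
  qed
  moreover have "Ipos \<inter> Ineg = {}"
  proof (rule equals0I)
    fix d assume "d \<in> Ipos \<inter> Ineg"
    then obtain r t where r: "r \<ge> 0" "energy (U d) (V d) r < 0" "\<And>s. s \<in> {0..r} \<Longrightarrow> U d s > 0"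
      and t: "t \<ge> 0" "U d t < 0" by (auto simp: Ipos_def Ineg_def)
    have "r < t" using r(3)[of t] t by (cases "t \<le> r") auto
    moreover have "continuous_on {r..t} (U d)"
      using radial_sol_cont_u[OF UV(1)] by (rule continuous_on_subset) (use r in auto)
    ultimately obtain z where z: "r \<le> z" "z \<le> t" "U d z = 0"
      using IVT2'[of "U d" t 0 r] r(1) r(3)[of r] t by auto
    have "energy (U d) (V d) z \<ge> 0" using z F_0 by (simp add: energy_def)
    then show False using energy_antimono[OF UV(1) r(1) z(1)] r(2) by (meson less_le_not_le order_trans)
  qed
  moreover have "Ipos \<inter> {0<..<b} \<noteq> {}"
  proof -
    have "energy (U (\<beta> / 2)) (V (\<beta> / 2)) 0 < 0"
      using energy_0[OF UV(1)] F_neg[of "\<beta> / 2"] \<beta> UV(2) by simp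
    then have "\<beta> / 2 \<in> Ipos" unfolding Ipos_def using UV(2) \<beta> by (auto intro!: exI[of _ 0])
    then show ?thesis using \<beta> by (auto intro!: exI[of _ "\<beta> / 2"])
  qed
  moreover have "Ineg \<inter> {0<..<b} \<noteq> {}"
  proof -
    obtain d where "0 < d" "d < b" "\<And>u v. sol u v \<Longrightarrow> u 0 = d \<Longrightarrow> \<exists>r\<ge>0. u r < 0"
      using crossing_solution by metis
    then have "d \<in> Ineg \<inter> {0<..<b}" using UV[of d] by (auto simp: Ineg_def)
    then show ?thesis by blast
  qed
  ultimately have "\<not> {0<..<b} \<subseteq> Ipos \<union> Ineg"
    using connectedD[of "{0<..<b}" Ipos Ineg] by (auto simp: is_interval_connected_1)
  then obtain d where "d \<in> {0<..<b}" and d': "d \<notin> Ipos" "d \<notin> Ineg" by blast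
  then have d: "0 < d" "d < b" by auto
  have nonneg: "U d r \<ge> 0" if "r \<ge> 0" for r using d'(2) that by (force simp: Ineg_def)
  have pos: "U d r > 0" if "r \<ge> 0" for r
    using positive_of_nonneg[OF UV(1) nonneg _ that] UV(2) d(1) by simp
  have "energy (U d) (V d) r \<ge> 0" if "r \<ge> 0" for r
    using d'(1) that pos by (force simp: Ipos_def)
  then have "ground_state (U d) (V d)"
    using ground_state_of_nonneg[OF UV(1) nonneg] UV(2) d by simp
  then show ?thesis using A that by blast
qed

end

section \<open>Uniqueness of the ground state\<close>

subsection \<open>Qualitative properties\<close>

context ground_state_nonlinearity
begin

lemma
  assumes "ground_state u v"
  shows ground_state_sol: "sol u v"
    and ground_state_pos: "\<And>r. r \<ge> 0 \<Longrightarrow> 0 < u r"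
    and ground_state_less: "\<And>r. r \<ge> 0 \<Longrightarrow> u r < b"
    and ground_state_lim: "(u \<longlongrightarrow> 0) at_top"
  using assms unfolding ground_state_def by auto

lemma
  assumes gs: "ground_state u v"
  shows ground_state_v_lim: "(v \<longlongrightarrow> 0) at_top"
    and ground_state_energy_nonneg: "\<And>r. r \<ge> 0 \<Longrightarrow> energy u v r \<ge> 0"
proof -
  have "0 \<le> u r \<and> u r \<le> b" if "r \<ge> 0" for r
    using ground_state_pos[OF gs that] ground_state_less[OF gs that] by simp
  note lim = limits_at_infinity[OF ground_state_sol[OF gs] this ground_state_lim[OF gs]]
  show "(v \<longlongrightarrow> 0) at_top" by (rule lim(1))
  show "\<And>r. r \<ge> 0 \<Longrightarrow> energy u v r \<ge> 0" using lim(4) F_0 by simp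
qed

lemma ground_state_v_neg:
  assumes gs: "ground_state u v" and r: "r > 0"
  shows "v r < 0"
proof (rule strictly_decreasing[OF ground_state_sol[OF gs] _ _ _ _ r])
  show "u 0 > 0" "u 0 < b" using ground_state_pos[OF gs] ground_state_less[OF gs] by auto
  show "u r \<ge> 0" if "r \<ge> 0" for r using ground_state_pos[OF gs that] by simp
  show "energy u v r \<ge> 0" if "r \<ge> 0" for r by (rule ground_state_energy_nonneg[OF gs that])
qed

lemma ground_state_decreasing:
  assumes gs: "ground_state u v" and r: "0 \<le> r" "r < t"
  shows "u t < u r"
  by (rule decreasing_of_neg[OF ground_state_sol[OF gs] ground_state_v_neg[OF gs] r])

lemma ground_state_antimono:
  assumes gs: "ground_state u v" and r: "0 \<le> r" "r \<le> t"
  shows "u t \<le> u r"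
  using ground_state_decreasing[OF gs, of r t] r by (cases "r = t") auto

lemma ground_state_eventually_less:
  assumes gs: "ground_state u v" and e: "e > 0"
  obtains R where "R > 0" "\<And>r. r \<ge> R \<Longrightarrow> u r < e"
proof -
  have "eventually (\<lambda>r. u r < e) at_top"
    using ground_state_lim[OF gs] e by (rule order_tendstoD(2))
  then obtain R where "\<And>r. r \<ge> R \<Longrightarrow> u r < e" unfolding eventually_at_top_linorder by blast
  then show ?thesis using that[of "max R 1"] by simp
qed

text \<open>Where \<open>u \<le> \<delta>\<close>, nonnegativity of the energy gives \<open>- v \<ge> \<kappa> u\<close>, hence exponential decay of
  \<open>u\<close>; there \<open>u\<close> is also convex, so \<open>- v r\<close> is bounded by the drop of \<open>u\<close> over \<open>{r - 1..r}\<close>.\<close>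

lemma ground_state_energy_decay:
  assumes gs: "ground_state u v"
  shows "((\<lambda>r. r ^ (2 * N) * energy u v r) \<longlongrightarrow> 0) at_top"
proof -
  note s = ground_state_sol[OF gs]
  obtain R where R: "R > 0" "\<And>r. r \<ge> R \<Longrightarrow> u r < \<delta>"
    using ground_state_eventually_less[OF gs \<delta>] by blast
  have slope: "\<kappa> * u r \<le> - v r" if r: "r \<ge> R" for r
  proof (rule power2_le_imp_le)
    have "r \<ge> 0" using r R by simp
    then have "energy u v r \<ge> 0" "F (u r) \<le> - (\<kappa>\<^sup>2 * (u r)\<^sup>2 / 2)"
      using ground_state_energy_nonneg[OF gs] F_quadratic[of "u r"] ground_state_pos[OF gs, of r] R(2)[OF r]
      by auto
    then show "(\<kappa> * u r)\<^sup>2 \<le> (- v r)\<^sup>2" by (simp add: energy_def power_mult_distrib)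
    show "0 \<le> - v r" using ground_state_v_neg[OF gs, of r] r R by simp
  qed
  define C where "C = exp (\<kappa> * R) * u R"
  have u_decay: "exp (\<kappa> * r) * u r \<le> C" if r: "r \<ge> R" for r
    unfolding C_def
  proof (rule DERIV_nonpos_imp_nonincreasing[where f = "\<lambda>r. exp (\<kappa> * r) * u r", OF r])
    fix x assume x: "R \<le> x" "x \<le> r"
    then have x0: "x > 0" using R by simp
    have "((\<lambda>r. exp (\<kappa> * r) * u r) has_real_derivative exp (\<kappa> * x) * (\<kappa> * u x + v x)) (at x)"
      by (auto intro!: derivative_eq_intros radial_sol_u[OF s x0] simp: algebra_simps)
    moreover have "exp (\<kappa> * x) * (\<kappa> * u x + v x) \<le> 0"
      using slope[of x] x by (intro mult_nonneg_nonpos) auto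
    ultimately show "\<exists>y. ((\<lambda>r. exp (\<kappa> * r) * u r) has_real_derivative y) (at x) \<and> y \<le> 0"
      by blast
  qed
  have v_mono: "v r \<le> v t" if r: "R \<le> r" "r \<le> t" for r t
  proof (rule DERIV_nonneg_imp_nondecreasing[OF r(2)])
    fix x assume x: "r \<le> x" "x \<le> t"
    then have x0: "x > 0" using R r by simp
    have "g (u x) < g 0"
      using g_decreasing[of 0 "u x"] ground_state_pos[OF gs, of x] R(2)[of x] x0 x r by simp
    moreover have "- (real N / x) * v x \<ge> 0"
      using ground_state_v_neg[OF gs x0] x0 by (intro mult_nonpos_nonpos) auto
    ultimately have "- (real N / x) * v x - g (u x) \<ge> 0" using g_nonpos[of 0] by linarith
    then show "\<exists>y. (v has_real_derivative y) (at x) \<and> y \<ge> 0"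
      using radial_sol_v[OF s x0] by blast
  qed
  have v_decay: "- v r \<le> C * exp \<kappa> * exp (- \<kappa> * r)" if r: "r \<ge> R + 1" for r
  proof -
    obtain \<xi> where \<xi>: "r - 1 < \<xi>" "\<xi> < r" "u r - u (r - 1) = (r - (r - 1)) * v \<xi>"
      using MVT2[of "r - 1" r u v] radial_sol_u[OF s] r R(1) by force
    have "- v r \<le> - v \<xi>" using v_mono[of \<xi> r] \<xi> r by simp
    also have "\<dots> \<le> u (r - 1)" using \<xi>(3) ground_state_pos[OF gs, of r] r R(1) by simp
    also have "\<dots> = exp (- \<kappa> * (r - 1)) * (exp (\<kappa> * (r - 1)) * u (r - 1))"
      by (simp add: exp_minus)
    also have "\<dots> \<le> exp (- \<kappa> * (r - 1)) * C"
      using u_decay[of "r - 1"] r by (intro mult_left_mono) auto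
    also have "exp (- \<kappa> * (r - 1)) = exp \<kappa> * exp (- \<kappa> * r)"
      by (simp add: exp_add[symmetric] algebra_simps)
    finally show ?thesis by (simp add: mult_ac)
  qed
  define D where "D = (C * exp \<kappa>)\<^sup>2 / 2"
  have energy_le: "energy u v r \<le> D / exp (2 * \<kappa> * r)" if r: "r \<ge> R + 1" for r
  proof -
    have "F (u r) \<le> - (\<kappa>\<^sup>2 * (u r)\<^sup>2 / 2)"
      using F_quadratic[of "u r"] ground_state_pos[OF gs, of r] R(1) R(2)[of r] r by simp
    also have "\<dots> \<le> 0" by simp
    finally have "energy u v r \<le> (- v r)\<^sup>2 / 2" by (simp add: energy_def)
    also have "(- v r)\<^sup>2 \<le> (C * exp \<kappa> * exp (- \<kappa> * r))\<^sup>2"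
      using v_decay[OF r] ground_state_v_neg[OF gs, of r] r R(1) by (intro power_mono) auto
    also have "\<dots> = (C * exp \<kappa>)\<^sup>2 * exp (2 * (- \<kappa> * r))"
      by (simp only: power_mult_distrib exp_double)
    also have "exp (2 * (- \<kappa> * r)) = 1 / exp (2 * \<kappa> * r)" by (simp add: exp_minus field_simps)
    finally show ?thesis by (simp add: D_def divide_right_mono)
  qed
  have "filterlim (\<lambda>r. 2 * \<kappa> * r) at_top at_top"
    by (rule filterlim_tendsto_pos_mult_at_top[OF tendsto_const]) (use \<kappa> in \<open>auto intro: filterlim_ident\<close>)
  from tendsto_mult[OF tendsto_const[of "D / (2 * \<kappa>) ^ (2 * N)"]
      filterlim_compose[OF tendsto_power_div_exp_0[of "2 * N"] this]]
  have lim: "((\<lambda>r. D / (2 * \<kappa>) ^ (2 * N) * ((2 * \<kappa> * r) ^ (2 * N) / exp (2 * \<kappa> * r))) \<longlongrightarrow> 0) at_top"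
    by simp
  show ?thesis
  proof (rule tendsto_sandwich[OF _ _ tendsto_const lim])
    show "eventually (\<lambda>r. 0 \<le> r ^ (2 * N) * energy u v r) at_top"
      by (rule eventually_at_top_linorderI[of 0]) (simp add: ground_state_energy_nonneg[OF gs])
    show "eventually (\<lambda>r. r ^ (2 * N) * energy u v r
        \<le> D / (2 * \<kappa>) ^ (2 * N) * ((2 * \<kappa> * r) ^ (2 * N) / exp (2 * \<kappa> * r))) at_top"
    proof (rule eventually_at_top_linorderI[of "R + 1"])
      fix r assume r: "R + 1 \<le> r"
      then have "r ^ (2 * N) * energy u v r \<le> r ^ (2 * N) * (D / exp (2 * \<kappa> * r))"
        using energy_le R(1) by (intro mult_left_mono) auto
      also have "\<dots> = D / (2 * \<kappa>) ^ (2 * N) * ((2 * \<kappa> * r) ^ (2 * N) / exp (2 * \<kappa> * r))"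
        using \<kappa> by (simp add: power_mult_distrib)
      finally show "r ^ (2 * N) * energy u v r
        \<le> D / (2 * \<kappa>) ^ (2 * N) * ((2 * \<kappa> * r) ^ (2 * N) / exp (2 * \<kappa> * r))" .
    qed
  qed
qed

subsection \<open>Radius and slope as functions of the level\<close>

text \<open>For a ground state, \<open>level u x\<close> is the radius at which \<open>u\<close> takes the value \<open>x\<close>, and
  \<open>slope u v x\<close> the absolute slope there.  Comparing two ground states at equal level instead of
  equal radius eliminates \<open>g\<close> from the difference of their energies.\<close>

definition level :: "(real \<Rightarrow> real) \<Rightarrow> real \<Rightarrow> real" where
  "level u = inv_into {0..} u"

definition slope :: "(real \<Rightarrow> real) \<Rightarrow> (real \<Rightarrow> real) \<Rightarrow> real \<Rightarrow> real" where
  "slope u v x = - v (level u x)"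

lemma level_of_value:
  assumes gs: "ground_state u v" and r: "r \<ge> 0"
  shows "level u (u r) = r"
proof -
  have "inj_on u {0..}"
    by (rule inj_onI) (metis atLeast_iff ground_state_decreasing[OF gs] less_irrefl linorder_neqE)
  then show ?thesis unfolding level_def by (rule inv_into_f_f) (use r in simp)
qed

lemma value_of_level:
  assumes gs: "ground_state u v" and x: "0 < x" "x \<le> u 0"
  shows "u (level u x) = x" "level u x \<ge> 0"
proof -
  obtain R where R: "R > 0" "\<And>r. r \<ge> R \<Longrightarrow> u r < x"
    using ground_state_eventually_less[OF gs x(1)] by blast
  have "continuous_on {0..R} u"
    using radial_sol_cont_u[OF ground_state_sol[OF gs]] by (rule continuous_on_subset) auto
  then obtain r where "0 \<le> r" "u r = x" using IVT2'[of u R x 0] R x by force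
  then have "x \<in> u ` {0..}" by auto
  then show "u (level u x) = x" "level u x \<ge> 0"
    unfolding level_def by (rule f_inv_into_f) (use inv_into_into[OF \<open>x \<in> u ` {0..}\<close>] in simp)
qed

lemma level_greater:
  assumes gs: "ground_state u v" and x: "0 < x" "x < u r" and r: "r \<ge> 0"
  shows "r < level u x"
proof (rule ccontr)
  assume "\<not> r < level u x"
  moreover have "x \<le> u 0" using x ground_state_antimono[OF gs order_refl r] by simp
  ultimately have "u r \<le> u (level u x)" "u (level u x) = x"
    using value_of_level[OF gs x(1)] ground_state_antimono[OF gs, of "level u x" r] by auto
  then show False using x by simp
qed

lemma level_pos:
  assumes gs: "ground_state u v" and x: "0 < x" "x < u 0"
  shows "0 < level u x"
  using level_greater[OF gs x] by simp

lemma slope_pos: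
  assumes gs: "ground_state u v" and x: "0 < x" "x < u 0"
  shows "0 < slope u v x"
  using ground_state_v_neg[OF gs level_pos[OF gs x]] by (simp add: slope_def)

lemma level_deriv:
  assumes gs: "ground_state u v" and x: "0 < x" "x < u 0"
  shows "(level u has_real_derivative - 1 / slope u v x) (at x)"
proof -
  note p = level_pos[OF gs x]
  have ux: "u (level u y) = y" if "0 < y" "y < u 0" for y
    using value_of_level[OF gs, of y] that by simp
  have "isCont (level u) (u (level u x))"
  proof (rule isCont_inverse_function[where d = "level u x / 2" and f = u and x = "level u x"])
    show "0 < level u x / 2" using p by simp
    fix z assume "\<bar>z - level u x\<bar> \<le> level u x / 2"
    then have z: "z > 0" using p by linarith
    then show "level u (u z) = z" using level_of_value[OF gs, of z] by simp
    show "isCont u z" by (rule DERIV_isCont[OF radial_sol_u[OF ground_state_sol[OF gs] z]])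
  qed
  then have "isCont (level u) x" using ux x by simp
  then have "(level u has_real_derivative inverse (v (level u x))) (at x)"
    by (intro DERIV_inverse_function[of u _ "level u" x 0 "u 0"]
        radial_sol_u[OF ground_state_sol[OF gs] p] x ux)
       (use ground_state_v_neg[OF gs p] in auto)
  then show ?thesis by (simp add: slope_def inverse_eq_divide)
qed

lemma slope_deriv:
  assumes gs: "ground_state u v" and x: "0 < x" "x < u 0"
  shows "(slope u v has_real_derivative real N / level u x - g x / slope u v x) (at x)"
proof -
  note p = level_pos[OF gs x]
  have ux: "u (level u x) = x" using value_of_level[OF gs] x by simp
  have "((\<lambda>x. - v (level u x)) has_real_derivative
      - ((- (real N / level u x) * v (level u x) - g (u (level u x))) * (- 1 / slope u v x))) (at x)"
    by (intro DERIV_minus DERIV_chain2[OF radial_sol_v[OF ground_state_sol[OF gs] p] level_deriv[OF gs x]])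
  moreover have "- ((- (real N / level u x) * v (level u x) - g (u (level u x))) * (- 1 / slope u v x))
      = real N / level u x - g x / slope u v x"
    using slope_pos[OF gs x] p by (simp add: ux slope_def field_simps)
  ultimately show ?thesis unfolding slope_def[abs_def] by simp
qed

lemma level_at_top:
  assumes gs: "ground_state u v"
  shows "filterlim (level u) at_top (at_right 0)"
  unfolding filterlim_at_top
proof
  fix Z :: real
  have "eventually (\<lambda>x. x \<in> {0<..<u (max Z 0)}) (at_right 0)"
    by (rule eventually_at_right_real) (simp add: ground_state_pos[OF gs])
  then show "eventually (\<lambda>x. Z \<le> level u x) (at_right 0)"
  proof eventually_elim
    case (elim x)
    then have "max Z 0 < level u x" by (intro level_greater[OF gs]) auto
    then show ?case by simp
  qed
qed

lemma slope_tendsto_0: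
  assumes gs: "ground_state u v"
  shows "(slope u v \<longlongrightarrow> 0) (at_right 0)"
  using tendsto_minus[OF filterlim_compose[OF ground_state_v_lim[OF gs] level_at_top[OF gs]]]
  by (simp add: slope_def[abs_def])

subsection \<open>Comparison of two ground states\<close>

text \<open>As long as the first ground state has the larger radius at every lower level, it is the
  flatter one: a positive difference of the slopes would increase towards the level zero (where
  \<open>g < 0\<close>), although both slopes tend to zero.\<close>

lemma slope_le_of_level_gt:
  assumes A: "ground_state uA vA" and B: "ground_state uB vB"
    and c: "c \<le> uA 0" "c \<le> uB 0"
    and lev: "\<And>x. 0 < x \<Longrightarrow> x < c \<Longrightarrow> level uB x < level uA x"
    and x: "0 < x" "x < c"
  shows "slope uA vA x \<le> slope uB vB x"
proof (rule ccontr)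
  define G where "G = (\<lambda>x. slope uA vA x - slope uB vB x)"
  define q where "q = (\<lambda>x. g x / (slope uA vA x * slope uB vB x))"
  define G' where "G' = (\<lambda>x. (real N / level uA x - g x / slope uA vA x)
      - (real N / level uB x - g x / slope uB vB x))"
  assume "\<not> slope uA vA x \<le> slope uB vB x"
  then have Gx: "G x > 0" by (simp add: G_def)
  have der: "(G has_real_derivative G' y) (at y)" if "0 < y" "y < c" for y
    unfolding G_def G'_def using that c by (intro DERIV_diff slope_deriv A B) auto
  have G'_le: "G' y \<le> q y * G y" if y: "0 < y" "y < c" for y
  proof -
    have pos: "slope uA vA y > 0" "slope uB vB y > 0" "level uB y > 0"
      using y c by (auto intro!: slope_pos[OF A] slope_pos[OF B] level_pos[OF B])
    have "real N / level uA y \<le> real N / level uB y"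
      using lev[OF y] pos by (intro divide_left_mono) auto
    moreover have "q y * G y = g y / slope uB vB y - g y / slope uA vA y"
      using pos by (simp add: q_def G_def field_simps)
    ultimately show ?thesis unfolding G'_def by simp
  qed
  have contG: "continuous_on {y..z} G" if "0 < y" "z < c" for y z
    by (intro continuous_at_imp_continuous_on ballI) (use that in \<open>auto intro!: DERIV_isCont der\<close>)
  have Gpos: "G y > 0" if y: "0 < y" "y < x" for y
  proof (rule ccontr)
    assume "\<not> G y > 0"
    then have Gy: "G y \<le> 0" by simp
    have "continuous_on {y..x} (slope uA vA)" "continuous_on {y..x} (slope uB vB)"
      using y x c by (auto intro!: continuous_at_imp_continuous_on DERIV_isCont
          slope_deriv[OF A] slope_deriv[OF B])
    moreover have "slope uA vA z > 0" "slope uB vB z > 0" if "z \<in> {y..x}" for z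
      using that y x c by (auto intro!: slope_pos[OF A] slope_pos[OF B])
    ultimately have "continuous_on {y..x} q"
      unfolding q_def by (intro continuous_intros continuous_g) force+
    then have "bounded (q ` {y..x})"
      by (intro compact_imp_bounded compact_continuous_image) auto
    then obtain K where K: "\<And>z. z \<in> {y..x} \<Longrightarrow> \<bar>q z\<bar> \<le> K"
      unfolding bounded_real by blast
    have "G x \<le> 0"
    proof (rule gronwall_nonpos[of y x G G' K])
      fix z assume z: "y < z" "z < x"
      show "(G has_real_derivative G' z) (at z)" using z y x by (intro der) auto
      assume "G z > 0"
      then have "q z * G z \<le> K * G z" using K[of z] z by (intro mult_right_mono) auto
      then show "G' z \<le> K * G z" using G'_le[of z] z y x by simp
    qed (use y x Gy contG in auto)
    then show False using Gx by simp
  qed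
  define m where "m = min \<delta> x / 2"
  have m: "0 < m" "m < x" "m < \<delta>" using \<delta> x by (auto simp: m_def min_def)
  have "G m \<le> G y" if y: "0 < y" "y < m" for y
  proof (rule DERIV_nonpos_imp_nonincreasing[where f = G])
    fix z assume z: "y \<le> z" "z \<le> m"
    have "g z < 0" using g_decreasing[of 0 z] g_nonpos[of 0] z y m by simp
    moreover have "slope uA vA z > 0" "slope uB vB z > 0"
      using z y m x c by (auto intro!: slope_pos[OF A] slope_pos[OF B])
    ultimately have "q z \<le> 0" by (simp add: q_def divide_nonpos_pos)
    then have "q z * G z \<le> 0" using Gpos[of z] z y m by (intro mult_nonpos_nonneg) auto
    then show "\<exists>d. (G has_real_derivative d) (at z) \<and> d \<le> 0"
      using der[of z] G'_le[of z] z y m x by (intro exI[of _ "G' z"]) auto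
  qed (use y in simp)
  then have "eventually (\<lambda>y. G m \<le> G y) (at_right 0)"
    using eventually_at_right_real[OF m(1)] by (auto elim!: eventually_mono)
  moreover have "(G \<longlongrightarrow> 0) (at_right 0)"
    unfolding G_def using tendsto_diff[OF slope_tendsto_0[OF A] slope_tendsto_0[OF B]] by simp
  ultimately have "G m \<le> 0" by (intro tendsto_lowerbound[of G 0 "at_right 0"]) auto
  then show False using Gpos[of m] m by simp
qed

text \<open>The quantity \<open>r\<^sup>2\<^sup>N E\<close> has radial derivative \<open>2 N r\<^sup>2\<^sup>N\<^sup>-\<^sup>1 F u\<close>, free of \<open>v\<close>; at levels below
  \<open>\<beta>\<close>, where \<open>F < 0\<close>, this makes it larger for the outer and flatter ground state.\<close>

definition weighted_energy :: "(real \<Rightarrow> real) \<Rightarrow> (real \<Rightarrow> real) \<Rightarrow> real \<Rightarrow> real" where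
  "weighted_energy u v x = level u x ^ (2 * N) * energy u v (level u x)"

lemma weighted_energy_deriv:
  assumes gs: "ground_state u v" and x: "0 < x" "x < u 0"
  shows "(weighted_energy u v has_real_derivative
      2 * real N * (- F x) * (level u x ^ (2 * N - 1) / slope u v x)) (at x)"
proof -
  define r where "r = level u x"
  have r: "r > 0" unfolding r_def by (rule level_pos[OF gs x])
  have ur: "u r = x" unfolding r_def using value_of_level[OF gs] x by simp
  have "((\<lambda>r. r ^ (2 * N) * energy u v r) has_real_derivative
      real (2 * N) * r ^ (2 * N - 1) * energy u v r + (- (real N / r) * (v r)\<^sup>2) * r ^ (2 * N)) (at r)"
    by (intro DERIV_mult energy_deriv[OF ground_state_sol[OF gs] r])
       (auto intro!: derivative_eq_intros)
  moreover have "real (2 * N) * r ^ (2 * N - 1) * energy u v r + (- (real N / r) * (v r)\<^sup>2) * r ^ (2 * N)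
      = 2 * real N * r ^ (2 * N - 1) * F x"
    using r ur by (cases N) (auto simp: energy_def field_simps)
  ultimately have "((\<lambda>r. r ^ (2 * N) * energy u v r) has_real_derivative
      2 * real N * r ^ (2 * N - 1) * F x) (at (level u x))" by (simp add: r_def)
  from DERIV_chain2[OF this level_deriv[OF gs x]]
  show ?thesis unfolding weighted_energy_def[abs_def] r_def by (simp add: field_simps)
qed

lemma weighted_energy_tendsto_0:
  assumes gs: "ground_state u v"
  shows "(weighted_energy u v \<longlongrightarrow> 0) (at_right 0)"
  unfolding weighted_energy_def[abs_def]
  by (rule filterlim_compose[OF ground_state_energy_decay[OF gs] level_at_top[OF gs]])

lemma weighted_energy_ge_of_level_gt:
  assumes A: "ground_state uA vA" and B: "ground_state uB vB"
    and c: "c \<le> uA 0" "c \<le> uB 0" "c \<le> \<beta>"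
    and lev: "\<And>x. 0 < x \<Longrightarrow> x < c \<Longrightarrow> level uB x < level uA x"
    and x: "0 < x" "x < c"
  shows "weighted_energy uB vB x \<le> weighted_energy uA vA x"
proof -
  define D where "D = (\<lambda>x. weighted_energy uA vA x - weighted_energy uB vB x)"
  have "D y \<le> D x" if y: "0 < y" "y < x" for y
  proof (rule DERIV_nonneg_imp_nondecreasing[where f = D])
    fix z assume z: "y \<le> z" "z \<le> x"
    then have z': "0 < z" "z < c" using x y by auto
    let ?d = "2 * real N * (- F z) * (level uA z ^ (2 * N - 1) / slope uA vA z)
        - 2 * real N * (- F z) * (level uB z ^ (2 * N - 1) / slope uB vB z)"
    have "(D has_real_derivative ?d) (at z)"
      unfolding D_def using z' c by (intro DERIV_diff weighted_energy_deriv A B) auto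
    moreover have "?d \<ge> 0"
    proof -
      have "level uB z ^ (2 * N - 1) / slope uB vB z \<le> level uA z ^ (2 * N - 1) / slope uA vA z"
      proof (rule frac_le)
        show "slope uA vA z \<le> slope uB vB z"
          by (rule slope_le_of_level_gt[OF A B c(1,2) lev z'])
        show "0 < slope uA vA z" using z' c by (intro slope_pos[OF A]) auto
        have "level uB z > 0" using z' c by (intro level_pos[OF B]) auto
        then show "level uB z ^ (2 * N - 1) \<le> level uA z ^ (2 * N - 1)"
          and "0 \<le> level uA z ^ (2 * N - 1)"
          using lev[OF z'] by (auto intro!: power_mono)
      qed
      moreover have "2 * real N * (- F z) \<ge> 0"
        using F_neg[of z] z' c by (intro mult_nonneg_nonneg) auto
      ultimately show ?thesis unfolding diff_ge_0_iff_ge by (rule mult_left_mono)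
    qed
    ultimately show "\<exists>d. (D has_real_derivative d) (at z) \<and> d \<ge> 0" by blast
  qed (use y in simp)
  then have "eventually (\<lambda>y. D y \<le> D x) (at_right 0)"
    using eventually_at_right_real[OF x(1)] by (auto elim!: eventually_mono)
  moreover have "(D \<longlongrightarrow> 0) (at_right 0)"
    unfolding D_def using tendsto_diff[OF weighted_energy_tendsto_0[OF A] weighted_energy_tendsto_0[OF B]]
    by simp
  ultimately have "0 \<le> D x" by (intro tendsto_upperbound[of D 0 "at_right 0"]) auto
  then show ?thesis by (simp add: D_def)
qed

text \<open>A maximum principle: at levels below \<open>\<delta>\<close>, where \<open>g\<close> decreases, the difference of two ground
  states has no positive local maximum.\<close>

lemma ordered_after_low_crossing:
  assumes A: "ground_state uA vA" and B: "ground_state uB vB"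
    and r0: "r0 > 0" and eq: "uA r0 = uB r0" and low: "uA r0 \<le> \<delta>" and r: "r \<ge> r0"
  shows "uA r \<le> uB r"
proof (rule ccontr)
  note sA = ground_state_sol[OF A] and sB = ground_state_sol[OF B]
  define w where "w = (\<lambda>r. uA r - uB r)"
  assume "\<not> uA r \<le> uB r"
  then have wr: "w r > 0" by (simp add: w_def)
  have "(w \<longlongrightarrow> 0 - 0) at_top"
    unfolding w_def by (intro tendsto_diff ground_state_lim[OF A] ground_state_lim[OF B])
  then have "eventually (\<lambda>t. w t < w r) at_top" using wr by (intro order_tendstoD(2)[of w 0]) auto
  then obtain R where R: "\<And>t. t \<ge> R \<Longrightarrow> w t < w r" unfolding eventually_at_top_linorder by blast
  have "continuous_on {r0..max R r} w" unfolding w_def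
    by (intro continuous_intros continuous_on_subset[OF radial_sol_cont_u[OF sA]]
        continuous_on_subset[OF radial_sol_cont_u[OF sB]]) (use r0 in auto)
  moreover have "{r0..max R r} \<noteq> {}" using r by auto
  ultimately have "\<exists>t\<in>{r0..max R r}. \<forall>s\<in>{r0..max R r}. w s \<le> w t"
    by (intro continuous_attains_sup compact_Icc)
  then obtain t where t: "t \<in> {r0..max R r}" "\<And>s. s \<in> {r0..max R r} \<Longrightarrow> w s \<le> w t" by blast
  have wt: "w t \<ge> w r" using t(2)[of r] r by simp
  have t_max: "w s \<le> w t" if "s \<ge> r0" for s
  proof (cases "s \<le> max R r")
    case True
    then show ?thesis using t(2) that by simp
  next
    case False
    then show ?thesis using R[of s] wt by force
  qed
  have "t \<noteq> r0" using wt wr eq by (auto simp: w_def)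
  then have t0: "t > r0" "t > 0" using t(1) r0 by auto
  have w': "(w has_real_derivative vA s - vB s) (at s)" if "s > 0" for s
    unfolding w_def by (intro DERIV_diff radial_sol_u[OF sA that] radial_sol_u[OF sB that])
  have "vA t - vB t = 0"
  proof (rule DERIV_local_max[OF w'[OF t0(2)]])
    show "0 < t - r0" using t0 by simp
    show "\<forall>s. \<bar>t - s\<bar> < t - r0 \<longrightarrow> w s \<le> w t" using t_max by auto
  qed
  moreover have "g (uA t) < g (uB t)"
  proof (rule g_decreasing)
    show "0 \<le> uB t" using ground_state_pos[OF B, of t] t0 by simp
    show "uB t < uA t" using wt wr by (simp add: w_def)
    show "uA t \<le> \<delta>" using ground_state_antimono[OF A, of r0 t] t0 r0 low by simp
  qed
  moreover have "((\<lambda>s. vA s - vB s) has_real_derivative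
      (- (real N / t) * vA t - g (uA t)) - (- (real N / t) * vB t - g (uB t))) (at t)"
    by (intro DERIV_diff radial_sol_v[OF sA t0(2)] radial_sol_v[OF sB t0(2)])
  ultimately obtain d where d: "d > 0" "\<And>h. h > 0 \<Longrightarrow> h < d \<Longrightarrow> vA (t + h) - vB (t + h) > 0"
    using DERIV_pos_inc_right[of "\<lambda>s. vA s - vB s" _ t] by force
  have "w t < w (t + d / 2)"
  proof (rule DERIV_pos_imp_increasing_open[where f = w])
    show "t < t + d / 2" using d by simp
    fix s assume s: "t < s" "s < t + d / 2"
    then show "\<exists>y. (w has_real_derivative y) (at s) \<and> y > 0"
      using w'[of s] d(2)[of "s - t"] t0 by (intro exI[of _ "vA s - vB s"]) auto
  next
    show "continuous_on {t..t + d / 2} w"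
      by (intro continuous_at_imp_continuous_on ballI DERIV_isCont[OF w']) (use t0 in auto)
  qed
  then show False using t_max[of "t + d / 2"] t0 d by simp
qed

lemma equal_of_low_crossing:
  assumes A: "ground_state uA vA" and B: "ground_state uB vB"
    and r0: "r0 > 0" and eq: "uA r0 = uB r0" and low: "uA r0 \<le> \<delta>" and r: "r \<ge> 0"
  shows "uA r = uB r"
proof -
  note sA = ground_state_sol[OF A] and sB = ground_state_sol[OF B]
  have same: "uA s = uB s" if "s \<ge> r0" for s
    using ordered_after_low_crossing[OF A B r0 eq low that]
      ordered_after_low_crossing[OF B A r0 eq[symmetric] _ that] low eq by simp
  have r1: "r0 + 1 > 0" using r0 by simp
  have "((\<lambda>s. uA s - uB s) has_real_derivative vA (r0 + 1) - vB (r0 + 1)) (at (r0 + 1))"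
    by (intro DERIV_diff radial_sol_u[OF sA r1] radial_sol_u[OF sB r1])
  then have "vA (r0 + 1) - vB (r0 + 1) = 0"
    by (rule DERIV_local_const[OF _ zero_less_one]) (use same in \<open>auto simp: abs_less_iff\<close>)
  then show ?thesis
    using radial_sol_unique_interior[OF sA sB r1 _ _ r] same[of "r0 + 1"] by simp
qed

text \<open>At the outermost crossing the solution that is outer afterwards has the smaller slope, and the
  level of the crossing exceeds \<open>\<beta>\<close>.\<close>

lemma crossing_level_gt:
  assumes A: "ground_state uA vA" and B: "ground_state uB vB"
    and z: "z > 0" and eq: "uA z = uB z" and outer: "\<And>r. r > z \<Longrightarrow> uB r < uA r"
  shows "vB z < vA z \<and> \<beta> < uA z"
proof -
  note sA = ground_state_sol[OF A] and sB = ground_state_sol[OF B]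
  define c where "c = uA z"
  have c: "0 < c" "c < uA 0" "c < uB 0"
    using ground_state_pos[OF A, of z] ground_state_decreasing[OF A _ z]
      ground_state_decreasing[OF B _ z] z eq by (auto simp: c_def)
  have levz: "level uA c = z" "level uB c = z"
    using level_of_value[OF A, of z] level_of_value[OF B, of z] z eq by (auto simp: c_def)
  have lev: "level uB x < level uA x" if x: "0 < x" "x < c" for x
  proof -
    have B': "uB (level uB x) = x" using value_of_level[OF B, of x] x c by simp
    have "z < level uB x" using level_greater[OF B, of x z] x eq z by (simp add: c_def)
    then have "x < uA (level uB x)" using outer[of "level uB x"] B' by simp
    then show ?thesis
      by (rule level_greater[OF A x(1)]) (use value_of_level[OF B, of x] x c in simp)
  qed
  have ev: "eventually (\<lambda>x. x \<in> {0<..<c}) (at_left c)" by (rule eventually_at_left_real[OF c(1)])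
  have contl: "(f \<longlongrightarrow> f c) (at_left c)" if "(f has_real_derivative d) (at c)" for f :: "real \<Rightarrow> real" and d
    using DERIV_isCont[OF that] by (simp add: isCont_def filterlim_at_split)
  have "slope uA vA c \<le> slope uB vB c"
  proof (rule tendsto_le[OF trivial_limit_at_left_real])
    show "(slope uB vB \<longlongrightarrow> slope uB vB c) (at_left c)"
      by (rule contl[OF slope_deriv[OF B c(1,3)]])
    show "(slope uA vA \<longlongrightarrow> slope uA vA c) (at_left c)"
      by (rule contl[OF slope_deriv[OF A c(1,2)]])
    show "eventually (\<lambda>x. slope uA vA x \<le> slope uB vB x) (at_left c)"
      using ev by eventually_elim (rule slope_le_of_level_gt[OF A B _ _ lev], use c in auto)
  qed
  then have v_le: "vB z \<le> vA z" by (simp add: slope_def levz)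
  have neq: "vB z \<noteq> vA z"
  proof
    assume "vB z = vA z"
    then have "uA (z + 1) = uB (z + 1)"
      using radial_sol_unique_interior[OF sA sB z eq, of "z + 1"] z by simp
    then show False using outer[of "z + 1"] by simp
  qed
  have "\<beta> < c"
  proof (rule ccontr)
    assume "\<not> \<beta> < c"
    then have cb: "c \<le> \<beta>" by simp
    have "weighted_energy uB vB c \<le> weighted_energy uA vA c"
    proof (rule tendsto_le[OF trivial_limit_at_left_real])
      show "(weighted_energy uA vA \<longlongrightarrow> weighted_energy uA vA c) (at_left c)"
        by (rule contl[OF weighted_energy_deriv[OF A c(1,2)]])
      show "(weighted_energy uB vB \<longlongrightarrow> weighted_energy uB vB c) (at_left c)"
        by (rule contl[OF weighted_energy_deriv[OF B c(1,3)]])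
      show "eventually (\<lambda>x. weighted_energy uB vB x \<le> weighted_energy uA vA x) (at_left c)"
        using ev by eventually_elim
          (rule weighted_energy_ge_of_level_gt[OF A B _ _ cb lev], use c in auto)
    qed
    then have "(vB z)\<^sup>2 \<le> (vA z)\<^sup>2"
      using z eq by (simp add: weighted_energy_def levz energy_def)
    then have "(- vB z)\<^sup>2 \<le> (- vA z)\<^sup>2" by simp
    then have "- vB z \<le> - vA z"
      by (rule power2_le_imp_le) (use ground_state_v_neg[OF A z] in simp)
    then show False using v_le neq by simp
  qed
  then show ?thesis using v_le neq by (simp add: c_def)
qed

text \<open>To the left of such a crossing the first ground state is the smaller one, and the Wronskian
  of \<open>uA - \<beta>\<close> and \<open>uB - \<beta>\<close> is nondecreasing, since \<open>g x / (x - \<beta>)\<close> is nonincreasing.  It is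
  nonnegative at the preceding crossing, or at \<open>r = 0\<close>, but negative at the crossing itself.\<close>

lemma no_crossing_above:
  assumes A: "ground_state uA vA" and B: "ground_state uB vB"
    and z: "z > 0" and eq: "uA z = uB z" and v: "vB z < vA z" and above: "\<beta> < uA z"
  shows False
proof -
  note sA = ground_state_sol[OF A] and sB = ground_state_sol[OF B]
  define w where "w = (\<lambda>r. uB r - uA r)"
  have w': "(w has_real_derivative vB s - vA s) (at s)" if "s > 0" for s
    unfolding w_def by (intro DERIV_diff radial_sol_u[OF sA that] radial_sol_u[OF sB that])
  have contw: "continuous_on {0..} w" unfolding w_def
    by (intro continuous_on_diff radial_sol_cont_u[OF sA] radial_sol_cont_u[OF sB])
  obtain d where d: "d > 0" "\<And>h. h > 0 \<Longrightarrow> h < d \<Longrightarrow> w (z - h) > 0"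
    using DERIV_neg_dec_left[OF w'[OF z]] v eq by (auto simp: w_def)
  define m where "m = min d z / 2"
  have m: "0 < m" "m < d" "m < z" using d(1) z by (auto simp: m_def min_def)
  define W where "W = (\<lambda>r. (uA r - \<beta>) * (r ^ N * vB r) - (uB r - \<beta>) * (r ^ N * vA r))"
  obtain y where y: "0 \<le> y" "y < z" "W y \<ge> 0" "\<And>r. y < r \<Longrightarrow> r < z \<Longrightarrow> w r > 0"
  proof (cases "\<forall>r. 0 < r \<and> r \<le> z - m \<longrightarrow> w r > 0")
    case True
    have "w r > 0" if r: "0 < r" "r < z" for r
      using d(2)[of "z - r"] True r m by (cases "r \<le> z - m") auto
    moreover have "W 0 = 0" using radial_sol_v0[OF sA] radial_sol_v0[OF sB] by (simp add: W_def)
    ultimately show ?thesis using that[of 0] z by simp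
  next
    case False
    then obtain r1 where r1: "0 < r1" "r1 \<le> z - m" "w r1 \<le> 0" by (auto simp: not_less)
    have "w (z - m) > 0" using d(2) m by simp
    then have "r1 < z - m" using r1 by (cases "r1 = z - m") auto
    moreover have "continuous_on {r1..z - m} w"
      by (rule continuous_on_subset[OF contw]) (use r1 in auto)
    ultimately obtain y where y: "r1 \<le> y" "y < z - m" "w y = 0"
        "\<And>x. y < x \<Longrightarrow> x \<le> z - m \<Longrightarrow> w x > 0"
      using last_zero[of r1 "z - m" w] r1 \<open>w (z - m) > 0\<close> by auto
    have y0: "y > 0" using y r1 by simp
    have pos: "w r > 0" if "y < r" "r < z" for r
      using d(2)[of "z - r"] y(4)[of r] that m by (cases "r \<le> z - m") auto
    have "vB y - vA y \<ge> 0"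
    proof (rule ccontr)
      assume "\<not> vB y - vA y \<ge> 0"
      then obtain e where e: "e > 0" "\<And>h. h > 0 \<Longrightarrow> h < e \<Longrightarrow> w (y + h) < w y"
        using DERIV_neg_dec_right[OF w'[OF y0]] by auto
      define h where "h = min e (z - y) / 2"
      have "0 < h" "h < e" "y + h < z"
        using e(1) y(2) m by (auto simp: h_def min_def field_simps)
      then show False using e(2)[of h] pos[of "y + h"] y(3) by simp
    qed
    moreover have "uA y > \<beta>" using ground_state_decreasing[OF A, of y z] above y0 y(2) m by simp
    moreover have "W y = (uA y - \<beta>) * (y ^ N * (vB y - vA y))"
      using y(3) by (simp add: W_def w_def algebra_simps)
    ultimately have "W y \<ge> 0" using y0 by simp
    then show ?thesis using that[of y] y0 y(2) m pos by simp
  qed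
  have "W y \<le> W z"
  proof (rule DERIV_nonneg_imp_increasing_open[where f = W])
    show "continuous_on {y..z} W" unfolding W_def
      by (intro continuous_intros continuous_on_subset[OF radial_sol_cont_u[OF sA]]
          continuous_on_subset[OF radial_sol_cont_u[OF sB]]
          continuous_on_subset[OF radial_sol_cont_v[OF sA]]
          continuous_on_subset[OF radial_sol_cont_v[OF sB]]) (use y in auto)
    fix r assume r: "y < r" "r < z"
    then have r0: "r > 0" using y by simp
    let ?D = "(uA r - \<beta>) * (- (r ^ N * g (uB r))) + vA r * (r ^ N * vB r)
        - ((uB r - \<beta>) * (- (r ^ N * g (uA r))) + vB r * (r ^ N * vA r))"
    have "((\<lambda>r. uA r - \<beta>) has_real_derivative vA r) (at r)"
      and "((\<lambda>r. uB r - \<beta>) has_real_derivative vB r) (at r)"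
      using DERIV_diff[OF radial_sol_u[OF sA r0] DERIV_const] DERIV_diff[OF radial_sol_u[OF sB r0] DERIV_const]
      by simp_all
    from DERIV_diff[OF DERIV_mult[OF this(1) radial_sol_flux[OF sB r0]]
        DERIV_mult[OF this(2) radial_sol_flux[OF sA r0]]]
    have "(W has_real_derivative ?D) (at r)" unfolding W_def by (simp add: algebra_simps)
    moreover have "?D \<ge> 0"
    proof -
      have "\<beta> < uA r" using ground_state_decreasing[OF A, of r z] above r0 r by simp
      moreover have "uA r \<le> uB r" using y(4)[OF r] by (simp add: w_def)
      moreover have "uB r < b" using ground_state_less[OF B, of r] r0 by simp
      ultimately have "g (uB r) * (uA r - \<beta>) \<le> g (uA r) * (uB r - \<beta>)"
        by (rule quotient_antimono)
      then have "r ^ N * (g (uB r) * (uA r - \<beta>)) \<le> r ^ N * (g (uA r) * (uB r - \<beta>))"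
        using r0 by (intro mult_left_mono) auto
      then show ?thesis by (simp add: algebra_simps)
    qed
    ultimately show "\<exists>d. (W has_real_derivative d) (at r) \<and> d \<ge> 0" by blast
  qed (use y in simp)
  moreover have "W z = (uA z - \<beta>) * (z ^ N * (vB z - vA z))"
    using eq by (simp add: W_def algebra_simps)
  then have "W z < 0" using above v z by (simp add: mult_pos_neg)
  ultimately show False using y(3) by simp
qed

text \<open>Without any crossing, at the top level of the inner ground state its slope vanishes while the
  slope of the outer one does not, against the comparison of slopes.\<close>

lemma not_eventually_outer:
  assumes A: "ground_state uA vA" and B: "ground_state uB vB"
    and R: "R \<ge> 0" "\<And>r. r \<ge> R \<Longrightarrow> uB r < uA r"
  shows False
proof (cases "\<forall>r\<ge>0. uB r < uA r")
  case True
  note sA = ground_state_sol[OF A] and sB = ground_state_sol[OF B]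
  define c where "c = uB 0"
  have c: "0 < c" "c < uA 0" using True ground_state_pos[OF B] by (auto simp: c_def)
  have lev: "level uB x < level uA x" if x: "0 < x" "x < c" for x
  proof -
    have B': "uB (level uB x) = x" "level uB x \<ge> 0"
      using value_of_level[OF B, of x] x by (auto simp: c_def)
    then have "x < uA (level uB x)" using True by metis
    then show ?thesis by (rule level_greater[OF A x(1) _ B'(2)])
  qed
  have le: "slope uA vA (uB r) \<le> - vB r" if r: "r > 0" for r
  proof -
    have "slope uA vA (uB r) \<le> slope uB vB (uB r)"
    proof (rule slope_le_of_level_gt[OF A B _ _ lev])
      show "uB r < c" unfolding c_def using r by (intro ground_state_decreasing[OF B]) auto
    qed (use c ground_state_pos[OF B, of r] r in \<open>auto simp: c_def\<close>)
    also have "\<dots> = - vB r" using level_of_value[OF B, of r] r by (simp add: slope_def)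
    finally show ?thesis .
  qed
  have "slope uA vA c \<le> - vB 0"
  proof (rule tendsto_le[OF trivial_limit_at_right_real])
    show "((\<lambda>r. - vB r) \<longlongrightarrow> - vB 0) (at_right 0)"
      by (intro tendsto_minus continuous_on_Ici_at_right radial_sol_cont_v[OF sB])
    have "isCont (slope uA vA) (uB 0)"
      using DERIV_isCont[OF slope_deriv[OF A c]] by (simp add: c_def)
    from isCont_tendsto_compose[OF this radial_sol_u_at_right_0[OF sB]]
    show "((\<lambda>r. slope uA vA (uB r)) \<longlongrightarrow> slope uA vA c) (at_right 0)" by (simp add: c_def)
    show "eventually (\<lambda>r. slope uA vA (uB r) \<le> - vB r) (at_right 0)"
      using eventually_at_right_less[of 0] by eventually_elim (rule le)
  qed
  then show False using slope_pos[OF A c] radial_sol_v0[OF sB] by simp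
next
  case False
  note sA = ground_state_sol[OF A] and sB = ground_state_sol[OF B]
  define w where "w = (\<lambda>r. uA r - uB r)"
  obtain r0 where r0: "r0 \<ge> 0" "w r0 \<le> 0" using False by (auto simp: w_def not_less)
  have "r0 < R" using r0 R(2)[of r0] by (auto simp: w_def not_le[symmetric])
  moreover have "continuous_on {r0..R} w" unfolding w_def
    by (intro continuous_intros continuous_on_subset[OF radial_sol_cont_u[OF sA]]
        continuous_on_subset[OF radial_sol_cont_u[OF sB]]) (use r0 in auto)
  ultimately obtain z where z: "r0 \<le> z" "z < R" "w z = 0" "\<And>x. z < x \<Longrightarrow> x \<le> R \<Longrightarrow> w x > 0"
    using last_zero[of r0 R w] r0 R(2)[of R] by (auto simp: w_def)
  have eq: "uA z = uB z" using z(3) by (simp add: w_def)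
  have outer: "uB r < uA r" if "r > z" for r
    using z(4)[of r] R(2)[of r] that by (cases "r \<le> R") (auto simp: w_def)
  have "z \<noteq> 0"
  proof
    assume "z = 0"
    then have "uA R = uB R" using radial_sol_unique[OF sA sB _ R(1)] eq by simp
    then show False using R(2)[of R] by simp
  qed
  then have z0: "z > 0" using z r0 by simp
  show False
    using crossing_level_gt[OF A B z0 eq outer] no_crossing_above[OF A B z0 eq] by blast
qed

theorem ground_state_unique:
  assumes A: "ground_state uA vA" and B: "ground_state uB vB" and r: "r \<ge> 0"
  shows "uA r = uB r"
proof (rule ccontr)
  note sA = ground_state_sol[OF A] and sB = ground_state_sol[OF B]
  assume neq: "uA r \<noteq> uB r"
  obtain RA where RA: "RA > 0" "\<And>r. r \<ge> RA \<Longrightarrow> uA r < \<delta>"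
    using ground_state_eventually_less[OF A \<delta>] by blast
  have no_zero: "uA s \<noteq> uB s" if "s \<ge> RA" for s
    using equal_of_low_crossing[OF A B _ _ _ r, of s] neq RA(1) RA(2)[OF that] that by auto
  have IVT: "\<exists>s. RA \<le> s \<and> uA s - uB s = 0"
    if "RA \<le> t" "(uA RA - uB RA) * (uA t - uB t) \<le> 0" for t
  proof -
    have "continuous_on {RA..t} (\<lambda>s. uA s - uB s)"
      by (intro continuous_intros continuous_on_subset[OF radial_sol_cont_u[OF sA]]
          continuous_on_subset[OF radial_sol_cont_u[OF sB]]) (use RA in auto)
    then show ?thesis
      using IVT'[of "\<lambda>s. uA s - uB s" RA 0 t] IVT2'[of "\<lambda>s. uA s - uB s" t 0 RA] that
      by (auto simp: mult_le_0_iff)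
  qed
  have sgn: "(uA RA - uB RA) * (uA t - uB t) > 0" if "t \<ge> RA" for t
    using IVT[OF that] no_zero by (metis eq_iff_diff_eq_0 not_less)
  show False
  proof (cases "uA RA > uB RA")
    case True
    then have "uB t < uA t" if "t \<ge> RA" for t using sgn[OF that] by (simp add: zero_less_mult_iff)
    then show False using not_eventually_outer[OF A B, of RA] RA(1) by simp
  next
    case False
    then have "uA t < uB t" if "t \<ge> RA" for t using sgn[OF that] by (simp add: zero_less_mult_iff)
    then show False using not_eventually_outer[OF B A, of RA] RA(1) by simp
  qed
qed

end

section \<open>The double-power nonlinearity\<close>

text \<open>The nonlinearity and its primitive vanishing at \<open>0\<close>, both meant for \<open>x \<ge> 0\<close>.\<close>

definition double_power :: "real \<Rightarrow> real \<Rightarrow> real \<Rightarrow> real" where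
  "double_power p \<omega> x = - \<omega> * x + x powr p - x powr (2 * p - 1)"

definition double_power_primitive :: "real \<Rightarrow> real \<Rightarrow> real \<Rightarrow> real" where
  "double_power_primitive p \<omega> x = - \<omega> * x\<^sup>2 / 2 + x powr (p + 1) / (p + 1) - x powr (2 * p) / (2 * p)"

text \<open>In terms of \<open>s = x powr (p - 1)\<close>, the nonlinearity is \<open>x\<close> times, and its primitive \<open>x\<^sup>2\<close> times,
  a quadratic polynomial in \<open>s\<close>.\<close>

lemma double_power_factor:
  assumes "x > 0"
  shows "double_power p \<omega> x = x * (x powr (p - 1) - (x powr (p - 1))\<^sup>2 - \<omega>)"
proof -
  have "x powr p = x powr (1 + (p - 1))" "x powr (2 * p - 1) = x powr (1 + (p - 1) + (p - 1))"
    by (simp_all add: algebra_simps)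
  then have "x powr p = x * x powr (p - 1)" "x powr (2 * p - 1) = x * x powr (p - 1) * x powr (p - 1)"
    using assms by (simp_all only: powr_add powr_one[OF less_imp_le])
  then show ?thesis unfolding double_power_def by (simp add: algebra_simps power2_eq_square)
qed

lemma double_power_primitive_factor:
  assumes "x > 0"
  shows "double_power_primitive p \<omega> x =
    x\<^sup>2 * (x powr (p - 1) / (p + 1) - (x powr (p - 1))\<^sup>2 / (2 * p) - \<omega> / 2)"
proof -
  have "x powr (p + 1) = x powr (1 + 1 + (p - 1))" "x powr (2 * p) = x powr (1 + 1 + (p - 1) + (p - 1))"
    by (simp_all add: algebra_simps)
  then have "x powr (p + 1) = x * x * x powr (p - 1)"
    "x powr (2 * p) = x * x * x powr (p - 1) * x powr (p - 1)"
    using assms by (simp_all only: powr_add powr_one[OF less_imp_le])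
  then show ?thesis unfolding double_power_primitive_def
    by (simp add: algebra_simps power2_eq_square)
qed

lemma double_power_0: "double_power p \<omega> 0 = 0"
  by (simp add: double_power_def)

lemma continuous_double_power:
  assumes "p > 1"
  shows "continuous_on {0..} (double_power p \<omega>)"
  unfolding double_power_def[abs_def]
  by (intro continuous_intros continuous_on_powr') (use assms in auto)

lemma double_power_deriv:
  assumes "x > 0"
  shows "(double_power p \<omega> has_real_derivative
    - \<omega> + p * x powr (p - 1) - (2 * p - 1) * (x powr (p - 1))\<^sup>2) (at x)"
proof -
  have "(double_power p \<omega> has_real_derivative
    - \<omega> + p * x powr (p - 1) - (2 * p - 1) * x powr (2 * p - 1 - 1)) (at x)"
    unfolding double_power_def[abs_def] using assms
    by (auto intro!: derivative_eq_intros has_real_derivative_powr)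
  moreover have "x powr (2 * p - 1 - 1) = (x powr (p - 1))\<^sup>2"
    by (simp add: power2_eq_square powr_add[symmetric])
  ultimately show ?thesis by simp
qed

lemma double_power_primitive_deriv:
  assumes "x > 0" "p > 1"
  shows "(double_power_primitive p \<omega> has_real_derivative double_power p \<omega> x) (at x)"
proof -
  have 1: "((\<lambda>x. x powr (p + 1)) has_real_derivative (p + 1) * x powr p) (at x)"
    and 2: "((\<lambda>x. x powr (2 * p)) has_real_derivative 2 * p * x powr (2 * p - 1)) (at x)"
    using has_real_derivative_powr[OF assms(1), of "p + 1"] has_real_derivative_powr[OF assms(1), of "2 * p"]
    by simp_all
  have "((\<lambda>x. - \<omega> * x\<^sup>2 / 2 + x powr (p + 1) / (p + 1) - x powr (2 * p) / (2 * p)) has_real_derivative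
      - \<omega> * (2 * x) / 2 + (p + 1) * x powr p / (p + 1) - 2 * p * x powr (2 * p - 1) / (2 * p)) (at x)"
    by (intro DERIV_diff DERIV_add DERIV_cdivide 1 2 DERIV_cmult) (auto intro!: derivative_eq_intros)
  then show ?thesis using assms
    unfolding double_power_primitive_def[abs_def] double_power_def by simp
qed

lemma continuous_double_power_primitive:
  assumes "p > 1"
  shows "continuous_on {0..} (double_power_primitive p \<omega>)"
  unfolding double_power_primitive_def[abs_def]
  by (intro continuous_intros continuous_on_powr') (use assms in auto)

lemma omega_bounds:
  assumes "p > 1" "a_crit p \<le> \<omega>" "\<omega> < omega_crit p"
  shows "0 < \<omega>" "\<omega> < 1 / 4"
proof -
  have "a_crit p > 0" using assms(1) by (simp add: a_crit_def)
  then show "0 < \<omega>" using assms(2) by simp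
  have "4 * p < (p + 1)\<^sup>2"
    using assms(1) zero_less_power2[of "p - 1"] by (simp add: power2_eq_square algebra_simps)
  then have "omega_crit p < 1 / 4" using assms(1) by (simp add: omega_crit_def field_simps)
  then show "\<omega> < 1 / 4" using assms(3) by simp
qed

text \<open>The two quadratics.  The condition \<open>\<omega> < omega_crit p\<close> makes the one of the primitive change
  sign, at \<open>s\<^sub>\<beta>\<close>; the condition \<open>a_crit p \<le> \<omega>\<close> says that it is nonpositive at the inflection value
  \<open>p / (2 (2 p - 1))\<close>, which is therefore at most \<open>s\<^sub>\<beta>\<close>.\<close>

lemma quadratic_roots:
  fixes p \<omega> :: real
  assumes p: "p > 1" and a: "a_crit p \<le> \<omega>" and o: "\<omega> < omega_crit p"
  defines "k \<equiv> \<lambda>s. s - s\<^sup>2 - \<omega>" and "q \<equiv> \<lambda>s. s / (p + 1) - s\<^sup>2 / (2 * p) - \<omega> / 2"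
  obtains s\<beta> sb where "0 < s\<beta>" "s\<beta> < sb" "1 / 2 \<le> sb" "p / (2 * (2 * p - 1)) \<le> s\<beta>" "k sb = 0"
    "\<And>s. s\<beta> \<le> s \<Longrightarrow> s < sb \<Longrightarrow> k s > 0" "\<And>s. sb < s \<Longrightarrow> k s < 0"
    "\<And>s. 0 < s \<Longrightarrow> s < s\<beta> \<Longrightarrow> q s < 0" "q sb > 0"
proof -
  note \<omega> = omega_bounds[OF p a o]
  define R where "R = sqrt (1 - 4 * \<omega>)"
  have R: "R > 0" "R\<^sup>2 = 1 - 4 * \<omega>" using \<omega> by (auto simp: R_def)
  define s1 where "s1 = (1 - R) / 2"
  define sb where "sb = (1 + R) / 2"
  have k: "k s = (s - s1) * (sb - s)" for s
    using R(2) by (simp add: k_def s1_def sb_def power2_eq_square field_simps)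
  have s1b: "s1 < sb" using R by (simp add: s1_def sb_def)
  define sv where "sv = p / (p + 1)"
  have sv: "sv > 0" "sv * (p + 1) = p" "1 - sv = 1 / (p + 1)"
    using p by (simp_all add: sv_def diff_divide_eq_iff)
  define D where "D = sqrt (1 - \<omega> * (p + 1)\<^sup>2 / p)"
  have "\<omega> * (p + 1)\<^sup>2 / p < 1" using o p by (simp add: omega_crit_def field_simps)
  moreover have "\<omega> * (p + 1)\<^sup>2 / p > 0" using \<omega> p by simp
  ultimately have D: "D > 0" "D < 1" "D\<^sup>2 = 1 - \<omega> * (p + 1)\<^sup>2 / p" by (auto simp: D_def)
  define s\<beta> where "s\<beta> = sv * (1 - D)"
  define s2 where "s2 = sv * (1 + D)"
  have s\<beta>: "0 < s\<beta>" "s\<beta> < sv" "sv < s2" using sv D by (auto simp: s\<beta>_def s2_def)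
  have prod: "s\<beta> * s2 = p * \<omega>"
  proof -
    have "s\<beta> * s2 = sv\<^sup>2 * (1 - D\<^sup>2)" by (simp add: s\<beta>_def s2_def power2_eq_square algebra_simps)
    also have "\<dots> = (sv * (p + 1))\<^sup>2 * \<omega> / p" unfolding D(3) by (simp add: power_mult_distrib)
    also have "\<dots> = p * \<omega>" unfolding sv(2) using p by (simp add: power2_eq_square)
    finally show ?thesis .
  qed
  have q_sv: "q s = (2 * s * sv - s\<^sup>2 - p * \<omega>) / (2 * p)" for s
  proof -
    have e: "s / (p + 1) = s * sv / p" using p by (simp add: sv_def)
    show ?thesis unfolding q_def e using p by (simp add: field_simps)
  qed
  have q: "q s = (s - s\<beta>) * (s2 - s) / (2 * p)" for s
  proof -
    have "(s - s\<beta>) * (s2 - s) = s * (s\<beta> + s2) - s\<^sup>2 - s\<beta> * s2"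
      by (simp add: power2_eq_square algebra_simps)
    also have "s\<beta> + s2 = 2 * sv" by (simp add: s\<beta>_def s2_def algebra_simps)
    finally show ?thesis unfolding prod by (simp add: q_sv mult_ac)
  qed
  \<comment> \<open>The relation between \<open>f\<close> and its primitive \<open>x\<^sup>2 q\<close>, in the variable \<open>s\<close>.\<close>
  have kq: "k s = 2 * q s + (p - 1) * s * ((sv - s) / p)" for s
  proof -
    have "2 * q s + (p - 1) * s * ((sv - s) / p) = (sv * (p + 1) * s - p * s\<^sup>2 - p * \<omega>) / p"
      using p by (simp add: q_sv field_simps power2_eq_square)
    then show ?thesis using p unfolding sv(2) by (simp add: k_def field_simps)
  qed
  have "k sv = sv * (1 - sv) - \<omega>" by (simp add: k_def power2_eq_square algebra_simps)
  also have "\<dots> = omega_crit p - \<omega>"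
    unfolding sv(3) by (simp add: sv_def omega_crit_def power2_eq_square)
  finally have "k sv > 0" using o by simp
  then have "sv < sb" using s1b unfolding k by (auto simp: zero_less_mult_iff)
  then have \<beta>b: "s\<beta> < sb" using s\<beta> by simp
  have "q s\<beta> = 0" by (simp add: q)
  then have "k s\<beta> > 0" unfolding kq using s\<beta> p by simp
  then have s1\<beta>: "s1 < s\<beta>" using \<beta>b unfolding k by (auto simp: zero_less_mult_iff)
  have kb: "k sb = 0" by (simp add: k)
  have "(p - 1) * sb * ((sv - sb) / p) < 0"
    using p \<open>sv < sb\<close> sv by (intro mult_pos_neg) (auto simp: divide_neg_pos)
  then have "q sb > 0" using kq[of sb] kb by simp
  define s0 where "s0 = p / (2 * (2 * p - 1))"
  have "q s0 = (a_crit p - \<omega>) / 2"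
  proof -
    have "2 * p - 1 \<noteq> 0" "p + 1 \<noteq> 0" "p \<noteq> 0" using p by auto
    then show ?thesis
      unfolding q_def s0_def a_crit_def
      by (simp add: divide_simps) (simp add: algebra_simps power2_eq_square)
  qed
  then have "q s0 \<le> 0" using a by simp
  moreover have "s0 \<le> sv"
    unfolding s0_def sv_def using p by (intro divide_left_mono) auto
  ultimately have "s0 \<le> s\<beta>" using s\<beta> p
    by (auto simp: q divide_le_0_iff mult_le_0_iff)
  show ?thesis
  proof (rule that[of s\<beta> sb])
    show "1 / 2 \<le> sb" using R by (simp add: sb_def)
    show "p / (2 * (2 * p - 1)) \<le> s\<beta>" using \<open>s0 \<le> s\<beta>\<close> by (simp add: s0_def)
    show "k s > 0" if "s\<beta> \<le> s" "s < sb" for s unfolding k using that s1\<beta> by simp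
    show "k s < 0" if "sb < s" for s unfolding k using that s1b by (intro mult_pos_neg) auto
    show "q s < 0" if "0 < s" "s < s\<beta>" for s
      unfolding q using that s\<beta> p by (intro divide_neg_pos mult_neg_pos) auto
  qed (use s\<beta> \<beta>b kb \<open>q sb > 0\<close> in auto)
qed

text \<open>The nonlinearity, frozen at its values \<open>0\<close> at the end points \<open>0\<close> and \<open>b\<close> outside \<open>{0..b}\<close>.
  It decreases where \<open>p s < \<omega>\<close>, whence the choice \<open>s = \<omega> / (2 p)\<close> for \<open>\<delta>\<close>.\<close>

lemma double_power_ground_state_nonlinearity:
  assumes p: "p > 1" and a: "a_crit p \<le> \<omega>" and o: "\<omega> < omega_crit p"
  obtains L F \<beta> b \<delta> \<kappa> where
    "ground_state_nonlinearity (\<lambda>x. double_power p \<omega> (max 0 (min b x))) L F \<beta> b \<delta> \<kappa>"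
    "\<forall>x>b. double_power p \<omega> x < 0"
proof -
  note \<omega> = omega_bounds[OF p a o]
  obtain s\<beta> sb where s\<beta>: "0 < s\<beta>" "s\<beta> < sb" "1 / 2 \<le> sb" and infl: "p / (2 * (2 * p - 1)) \<le> s\<beta>"
    and kb: "sb - sb\<^sup>2 - \<omega> = 0"
    and kpos: "\<And>s. s\<beta> \<le> s \<Longrightarrow> s < sb \<Longrightarrow> s - s\<^sup>2 - \<omega> > 0"
    and kneg: "\<And>s. sb < s \<Longrightarrow> s - s\<^sup>2 - \<omega> < 0"
    and qneg: "\<And>s. 0 < s \<Longrightarrow> s < s\<beta> \<Longrightarrow> s / (p + 1) - s\<^sup>2 / (2 * p) - \<omega> / 2 < 0"
    and qpos: "sb / (p + 1) - sb\<^sup>2 / (2 * p) - \<omega> / 2 > 0"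
    using quadratic_roots[OF p a o] by metis
  define f where "f = double_power p \<omega>"
  define \<sigma> where "\<sigma> = (\<lambda>x::real. x powr (p - 1))"
  define inv where "inv = (\<lambda>s::real. s powr (1 / (p - 1)))"
  have \<sigma>_inv: "\<sigma> (inv s) = s" if "s > 0" for s
    using that p by (simp add: \<sigma>_def inv_def powr_powr)
  have inv_pos: "inv s > 0" if "s > 0" for s using that by (simp add: inv_def)
  have inv_less: "inv s < inv t" if "0 < s" "s < t" for s t
    using that p by (auto simp: inv_def intro!: powr_less_mono2)
  have \<sigma>_less: "\<sigma> x < \<sigma> y" if "0 \<le> x" "x < y" for x y
    using that p by (auto simp: \<sigma>_def intro!: powr_less_mono2)
  have \<sigma>_le: "\<sigma> x \<le> \<sigma> y" if "0 \<le> x" "x \<le> y" for x y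
    using that p by (auto simp: \<sigma>_def intro!: powr_mono2)
  have \<sigma>_pos: "\<sigma> x > 0" if "x > 0" for x using that by (simp add: \<sigma>_def)
  define \<beta> b \<delta> where "\<beta> = inv s\<beta>" and "b = inv sb" and "\<delta> = inv (\<omega> / (2 * p))"
  have s\<delta>: "0 < \<omega> / (2 * p)" "\<omega> / (2 * p) < 1 / 2"
    using \<omega> p by (auto simp: field_simps)
  have \<beta>: "0 < \<beta>" "\<beta> < b" using s\<beta> by (auto simp: \<beta>_def b_def inv_pos inv_less)
  have \<delta>: "0 < \<delta>" "\<delta> < b" using s\<delta> s\<beta> by (auto simp: \<delta>_def b_def inv_pos inv_less)
  have \<sigma>\<beta>: "\<sigma> \<beta> = s\<beta>" and \<sigma>b: "\<sigma> b = sb" and \<sigma>\<delta>: "\<sigma> \<delta> = \<omega> / (2 * p)"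
    unfolding \<beta>_def b_def \<delta>_def using s\<beta> s\<delta>(1) by (auto intro!: \<sigma>_inv)
  have f_eq: "f x = x * (\<sigma> x - (\<sigma> x)\<^sup>2 - \<omega>)" if "x > 0" for x
    using double_power_factor[OF that] by (simp add: f_def \<sigma>_def)
  have f0: "f 0 = 0" by (simp add: f_def double_power_0)
  have fb: "f b = 0" using f_eq[of b] \<beta> kb \<sigma>b by simp
  have f_cont: "continuous_on {x..y} f" if "0 \<le> x" for x y
    unfolding f_def by (rule continuous_on_subset[OF continuous_double_power[OF p]]) (use that in auto)
  define f' where "f' = (\<lambda>x. - \<omega> + p * \<sigma> x - (2 * p - 1) * (\<sigma> x)\<^sup>2)"
  have f': "(f has_real_derivative f' x) (at x)" if "x > 0" for x
    using double_power_deriv[OF that] by (simp add: f_def f'_def \<sigma>_def)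
  \<comment> \<open>At \<open>0\<close> only continuity is used, hence the mean value theorem with open interval.\<close>
  have mvt: "\<exists>z. x < z \<and> z < y \<and> f y - f x = (y - x) * f' z" if xy: "0 \<le> x" "x < y" for x y
  proof -
    have "\<exists>l z. x < z \<and> z < y \<and> (f has_real_derivative l) (at z) \<and> f y - f x = (y - x) * l"
    proof (rule MVT[OF xy(2) f_cont[OF xy(1)]])
      fix z assume "x < z" "z < y"
      then show "f differentiable (at z)"
        using f'[of z] xy by (auto simp: real_differentiable_def)
    qed
    then show ?thesis using DERIV_unique[OF f'] xy by (metis le_less_trans)
  qed
  define g where "g = (\<lambda>x. f (max 0 (min b x)))"
  have g_eq: "g x = f x" if "0 \<le> x" "x \<le> b" for x using that by (simp add: g_def)
  define L where "L = \<omega> + p * sb + (2 * p - 1) * sb\<^sup>2"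
  have L: "L > 0" using \<omega> p s\<beta> by (auto simp: L_def intro!: add_pos_nonneg)
  have f_lip: "\<bar>f y - f x\<bar> \<le> L * (y - x)" if xy: "0 \<le> x" "x < y" "y \<le> b" for x y
  proof -
    obtain z where z: "x < z" "z < y" "f y - f x = (y - x) * f' z" using mvt[OF xy(1,2)] by auto
    have s: "0 < \<sigma> z" "\<sigma> z \<le> sb"
      using \<sigma>_pos[of z] \<sigma>_le[of z b] z xy \<sigma>b by auto
    then have "p * \<sigma> z \<le> p * sb" "(2 * p - 1) * (\<sigma> z)\<^sup>2 \<le> (2 * p - 1) * sb\<^sup>2"
      using p by (auto intro!: mult_left_mono power_mono)
    moreover have "0 \<le> p * \<sigma> z" "0 \<le> (2 * p - 1) * (\<sigma> z)\<^sup>2" using s p by auto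
    ultimately have "\<bar>f' z\<bar> \<le> L" using \<omega> unfolding f'_def L_def by linarith
    then have "\<bar>f' z\<bar> * (y - x) \<le> L * (y - x)" using xy by (intro mult_right_mono) auto
    then show ?thesis using z(3) xy by (simp add: abs_mult mult.commute)
  qed
  have g_lip: "\<bar>g x - g y\<bar> \<le> L * \<bar>x - y\<bar>" for x y
  proof -
    define cx cy where "cx = max 0 (min b x)" and "cy = max 0 (min b y)"
    have c: "0 \<le> cx" "cx \<le> b" "0 \<le> cy" "cy \<le> b" "\<bar>cx - cy\<bar> \<le> \<bar>x - y\<bar>"
      using \<beta> by (auto simp: cx_def cy_def max_def min_def)
    have "\<bar>f cx - f cy\<bar> \<le> L * \<bar>cx - cy\<bar>"
      using f_lip[of cx cy] f_lip[of cy cx] c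
      by (cases cx cy rule: linorder_cases) (auto simp: abs_minus_commute)
    also have "\<dots> \<le> L * \<bar>x - y\<bar>" using c L by (intro mult_left_mono) auto
    finally show ?thesis by (simp add: g_def cx_def cy_def)
  qed
  interpret lipschitz_nonlinearity g L
    using L g_lip by unfold_locales
  have "\<exists>F0. \<forall>x. (F0 has_real_derivative g x) (at x)"
    using einterval_antiderivative[of "-\<infinity>" "\<infinity>" g] continuous_g[of UNIV]
    by (auto simp: has_real_derivative_iff_has_vector_derivative continuous_on_eq_continuous_at)
  then obtain F0 where F0: "\<And>x. (F0 has_real_derivative g x) (at x)" by blast
  define F where "F = (\<lambda>x. F0 x - F0 0)"
  have F: "(F has_real_derivative g x) (at x)" for x
    unfolding F_def using DERIV_diff[OF F0 DERIV_const] by simp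
  define Fp where "Fp = double_power_primitive p \<omega>"
  have Fp0: "Fp 0 = 0" by (simp add: Fp_def double_power_primitive_def)
  have F_eq: "F x = Fp x" if x: "0 < x" "x \<le> b" for x
  proof -
    have "F x - Fp x = F 0 - Fp 0"
    proof (rule DERIV_isconst_end[OF x(1), where f = "\<lambda>x. F x - Fp x"])
      show "continuous_on {0..x} (\<lambda>x. F x - Fp x)"
        unfolding Fp_def
        by (intro continuous_intros continuous_on_subset[OF continuous_double_power_primitive[OF p]]
            continuous_at_imp_continuous_on ballI DERIV_isCont[OF F]) auto
      fix y assume "0 < y" "y < x"
      then have "(Fp has_real_derivative g y) (at y)"
        using double_power_primitive_deriv[OF _ p, of y] g_eq[of y] x by (simp add: Fp_def f_def)
      from DERIV_diff[OF F this] show "((\<lambda>x. F x - Fp x) has_real_derivative 0) (at y)" by simp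
    qed
    then show ?thesis by (simp add: Fp0 F_def)
  qed
  have F_eq': "F x = x\<^sup>2 * (\<sigma> x / (p + 1) - (\<sigma> x)\<^sup>2 / (2 * p) - \<omega> / 2)" if "0 < x" "x \<le> b" for x
    using F_eq[OF that] double_power_primitive_factor[OF that(1)] by (simp add: Fp_def \<sigma>_def)
  define \<kappa> where "\<kappa> = sqrt (\<omega> / 2)"
  have \<kappa>: "\<kappa> > 0" "\<kappa>\<^sup>2 = \<omega> / 2" using \<omega> by (auto simp: \<kappa>_def)
  have f'_anti: "f' y \<le> f' x" if "\<beta> \<le> x" "x < y" for x y
  proof -
    have s: "s\<beta> \<le> \<sigma> x" "\<sigma> x \<le> \<sigma> y" using \<sigma>_le that \<beta> \<sigma>\<beta> by (metis less_imp_le order_trans)+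
    then have "2 * (p / (2 * (2 * p - 1))) \<le> \<sigma> x + \<sigma> y" using infl by linarith
    then have "p \<le> (2 * p - 1) * (\<sigma> x + \<sigma> y)" using p by (simp add: field_simps)
    then have "p * (\<sigma> y - \<sigma> x) \<le> (2 * p - 1) * (\<sigma> x + \<sigma> y) * (\<sigma> y - \<sigma> x)"
      using s by (intro mult_right_mono) auto
    then show ?thesis by (simp add: f'_def algebra_simps power2_eq_square)
  qed
  have f_pos: "f x > 0" if "\<beta> \<le> x" "x < b" for x
  proof -
    have "s\<beta> \<le> \<sigma> x" "\<sigma> x < sb" using \<sigma>_le[of \<beta> x] \<sigma>_less[of x b] \<sigma>\<beta> \<sigma>b that \<beta> by auto
    then show ?thesis using f_eq[of x] kpos[of "\<sigma> x"] that \<beta> by simp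
  qed
  have "ground_state_nonlinearity g L F \<beta> b \<delta> \<kappa>"
  proof unfold_locales
    show "0 < \<beta>" "\<beta> < b" "0 < \<delta>" "0 < \<kappa>" by (fact \<beta> \<delta> \<kappa>)+
    show "g x = 0" if "x \<le> 0" for x using that \<beta> f0 by (simp add: g_def min_def max_def)
    show "g x = 0" if "x \<ge> b" for x using that \<beta> fb by (simp add: g_def)
    show "(F has_real_derivative g x) (at x)" for x by (rule F)
    show "F 0 = 0" by (simp add: F_def)
    show "F x < 0" if "0 < x" "x < \<beta>" for x
      using F_eq'[of x] qneg[OF \<sigma>_pos[of x]] \<sigma>_less[of x \<beta>] that \<beta> \<sigma>\<beta> by (simp add: mult_pos_neg)
    show "F b > 0" using F_eq'[of b] qpos \<beta> \<sigma>b by simp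
    show "g x > 0" if "\<beta> \<le> x" "x < b" for x using f_pos[OF that] g_eq[of x] that \<beta> by simp
    show "g y < g x" if xy: "0 \<le> x" "x < y" "y \<le> \<delta>" for x y
    proof -
      obtain z where z: "x < z" "z < y" "f y - f x = (y - x) * f' z" using mvt[OF xy(1,2)] by auto
      have s: "0 < \<sigma> z" "\<sigma> z \<le> \<omega> / (2 * p)"
        using \<sigma>_pos[of z] \<sigma>_le[of z \<delta>] z xy \<sigma>\<delta> by auto
      have "p * \<sigma> z \<le> p * (\<omega> / (2 * p))" using s p by (intro mult_left_mono) auto
      also have "\<dots> < \<omega>" using p \<omega> by simp
      finally have "p * \<sigma> z < \<omega>" .
      moreover have "(2 * p - 1) * (\<sigma> z)\<^sup>2 \<ge> 0" using p by simp
      ultimately have "f' z < 0" by (simp add: f'_def)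
      then have "f y < f x" using z(3) xy mult_pos_neg[of "y - x" "f' z"] by simp
      then show ?thesis using g_eq[of x] g_eq[of y] xy \<delta> by simp
    qed
    show "F x \<le> - (\<kappa>\<^sup>2 * x\<^sup>2 / 2)" if x: "0 \<le> x" "x \<le> \<delta>" for x
    proof (cases "x = 0")
      case True
      then show ?thesis by (simp add: F_def)
    next
      case False
      then have x0: "x > 0" using x by simp
      have "\<sigma> x \<le> \<omega> / (2 * p)" using \<sigma>_le[of x \<delta>] x \<sigma>\<delta> by simp
      then have "\<sigma> x / (p + 1) \<le> \<omega> / (2 * p) / (p + 1)" using p by (intro divide_right_mono) auto
      also have "\<dots> \<le> \<omega> / 4"
      proof -
        have "4 \<le> 2 * p * (p + 1)" using p mult_mono[of 1 p 2 "p + 1"] by simp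
        then show ?thesis using \<omega> p by (simp add: divide_simps)
      qed
      finally have "\<sigma> x / (p + 1) \<le> \<omega> / 4" .
      moreover have "(\<sigma> x)\<^sup>2 / (2 * p) \<ge> 0" using p by simp
      ultimately have "\<sigma> x / (p + 1) - (\<sigma> x)\<^sup>2 / (2 * p) - \<omega> / 2 \<le> - (\<omega> / 4)" by linarith
      then have "x\<^sup>2 * (\<sigma> x / (p + 1) - (\<sigma> x)\<^sup>2 / (2 * p) - \<omega> / 2) \<le> x\<^sup>2 * - (\<omega> / 4)"
        by (rule mult_left_mono) simp
      then have "F x \<le> x\<^sup>2 * - (\<omega> / 4)" using F_eq'[OF x0] x \<delta> by simp
      then show ?thesis unfolding \<kappa>(2) by (simp add: mult.commute)
    qed
    show "g y * (x - \<beta>) \<le> g x * (y - \<beta>)" if xy: "\<beta> < x" "x \<le> y" "y < b" for x y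
    proof (cases "x = y")
      case False
      then have less: "x < y" using xy by simp
      obtain z1 where z1: "\<beta> < z1" "z1 < x" "f x - f \<beta> = (x - \<beta>) * f' z1"
        using mvt[of \<beta> x] \<beta> xy by auto
      obtain z2 where z2: "x < z2" "z2 < y" "f y - f x = (y - x) * f' z2"
        using mvt[of x y] \<beta> xy less by auto
      have "(x - \<beta>) * f' z2 \<le> (x - \<beta>) * f' z1"
        using f'_anti[of z1 z2] z1 z2 xy by (intro mult_left_mono) auto
      also have "\<dots> \<le> f x" using z1(3) f_pos[of \<beta>] \<beta> by simp
      finally have "(y - x) * ((x - \<beta>) * f' z2) \<le> (y - x) * f x" using less by (intro mult_left_mono) auto
      moreover have "f y * (x - \<beta>) = f x * (x - \<beta>) + (y - x) * ((x - \<beta>) * f' z2)"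
      proof -
        have fy: "f y = f x + (y - x) * f' z2" using z2(3) by simp
        show ?thesis unfolding fy by (simp add: algebra_simps)
      qed
      ultimately have "f y * (x - \<beta>) \<le> f x * (y - \<beta>)" by (simp add: algebra_simps)
      then show ?thesis using g_eq[of x] g_eq[of y] xy \<beta> by simp
    qed simp
  qed
  moreover have "double_power p \<omega> x < 0" if "b < x" for x
  proof -
    have "sb < \<sigma> x" using \<sigma>_less[of b x] that \<beta> \<sigma>b by simp
    then show ?thesis using f_eq[of x] kneg[of "\<sigma> x"] that \<beta> by (simp add: f_def mult_pos_neg)
  qed
  ultimately show ?thesis using that unfolding g_def f_def by blast
qed

section \<open>Existence and uniqueness\<close>

text \<open>A decaying solution attains its maximum; there the flux \<open>r\<^sup>N v\<close> vanishes, and if the maximum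
  exceeded \<open>b\<close>, where the nonlinearity is negative, the flux would increase beyond it.\<close>

lemma decaying_radial_sol_le:
  assumes s: "radial_sol N f u v" and pos: "\<And>r. r \<ge> 0 \<Longrightarrow> u r > 0" and lim: "(u \<longlongrightarrow> 0) at_top"
    and neg: "\<And>x. b < x \<Longrightarrow> f x < 0" and r: "r \<ge> 0"
  shows "u r \<le> b"
proof (rule ccontr)
  assume "\<not> u r \<le> b"
  then have ur: "b < u r" by simp
  have "eventually (\<lambda>t. u t < u r) at_top" using lim pos[OF r] by (rule order_tendstoD(2))
  then obtain R where R: "\<And>t. t \<ge> R \<Longrightarrow> u t < u r" unfolding eventually_at_top_linorder by blast
  have "continuous_on {0..max R r} u"
    by (rule continuous_on_subset[OF radial_sol_cont_u[OF s]]) auto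
  moreover have "{0..max R r} \<noteq> {}" using r by auto
  ultimately have "\<exists>t\<in>{0..max R r}. \<forall>s\<in>{0..max R r}. u s \<le> u t"
    by (intro continuous_attains_sup compact_Icc)
  then obtain t where t: "t \<in> {0..max R r}" "\<And>s. s \<in> {0..max R r} \<Longrightarrow> u s \<le> u t" by blast
  have ut: "u r \<le> u t" using t(2)[of r] r by simp
  have t_max: "u s \<le> u t" if "s \<ge> 0" for s
  proof (cases "s \<le> max R r")
    case True
    then show ?thesis using t(2) that by simp
  next
    case False
    then show ?thesis using R[of s] ut by force
  qed
  have t0: "t \<ge> 0" using t(1) by simp
  have vt: "v t = 0"
  proof (cases "t = 0")
    case True
    then show ?thesis using radial_sol_v0[OF s] by simp
  next
    case False
    then have "t > 0" using t0 by simp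
    show ?thesis
      by (rule DERIV_local_max[OF radial_sol_u[OF s \<open>t > 0\<close>] \<open>t > 0\<close>]) (use t_max in auto)
  qed
  have "(u \<longlongrightarrow> u t) (at t within {0..})"
    using radial_sol_cont_u[OF s] t0 unfolding continuous_on_def by simp
  then have "(u \<longlongrightarrow> u t) (at_right t)" by (rule tendsto_within_subset) (use t0 in auto)
  then have "eventually (\<lambda>s. b < u s) (at_right t)"
    by (rule order_tendstoD(1)) (use ur ut in simp)
  then obtain e where e: "e > t" "\<And>s. t < s \<Longrightarrow> s < e \<Longrightarrow> b < u s"
    by (auto simp: eventually_at_right_field)
  have v_pos: "v s > 0" if st: "t < s" "s < e" for s
  proof -
    have "t ^ N * v t < s ^ N * v s"
    proof (rule DERIV_pos_imp_increasing_open[OF st(1), where f = "\<lambda>r. r ^ N * v r"])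
      show "continuous_on {t..s} (\<lambda>r. r ^ N * v r)"
        by (intro continuous_intros continuous_on_subset[OF radial_sol_cont_v[OF s]]) (use t0 in auto)
      fix x assume x: "t < x" "x < s"
      then have x0: "x > 0" using t0 by simp
      have "- (x ^ N * f (u x)) > 0"
        using neg[OF e(2)[of x]] x st x0 by (simp add: mult_pos_neg)
      then show "\<exists>y. ((\<lambda>r. r ^ N * v r) has_real_derivative y) (at x) \<and> y > 0"
        using radial_sol_flux[OF s x0] by blast
    qed
    then have "0 < s ^ N * v s" using vt by simp
    then show ?thesis using st t0 by (simp add: zero_less_mult_iff)
  qed
  define m where "m = (t + e) / 2"
  have m: "t < m" "m < e" using e(1) by (auto simp: m_def)
  have "u t < u m"
  proof (rule DERIV_pos_imp_increasing_open[OF m(1)])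
    show "continuous_on {t..m} u"
      by (rule continuous_on_subset[OF radial_sol_cont_u[OF s]]) (use t0 in auto)
    fix x assume x: "t < x" "x < m"
    then show "\<exists>y. (u has_real_derivative y) (at x) \<and> y > 0"
      using v_pos[of x] radial_sol_u[OF s, of x] m t0 by auto
  qed
  then show False using t_max[of m] m t0 by simp
qed

lemma positive_solution_radial_sol:
  assumes "n \<ge> 1" "positive_solution n p \<omega> u"
  obtains v where "radial_sol (n - 1) (double_power p \<omega>) u v"
proof -
  obtain u' u'' where d: "\<And>r. r \<ge> 0 \<Longrightarrow> (u has_real_derivative u' r) (at r within {0..})"
      "\<And>r. r \<ge> 0 \<Longrightarrow> (u' has_real_derivative u'' r) (at r within {0..})" "u' 0 = 0"
    and eq: "\<And>r. r > 0 \<Longrightarrow> u'' r + (real n - 1) / r * u' r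
                 - \<omega> * u r + u r powr p - u r powr (2 * p - 1) = 0"
    using assms(2) unfolding positive_solution_def by blast
  have "radial_sol (n - 1) (double_power p \<omega>) u u'"
    unfolding radial_sol_def
  proof (intro conjI allI impI)
    show "continuous_on {0..} u'" by (rule DERIV_continuous_on[of _ _ u'']) (use d(2) in auto)
    fix r :: real assume r: "r > 0"
    have "u'' r = - (real (n - 1) / r) * u' r - double_power p \<omega> (u r)"
      using eq[OF r] assms(1) by (simp add: double_power_def)
    moreover have "(u' has_real_derivative u'' r) (at r)"
      using d(2)[of r] r within_Ici_eq_at[OF r] by simp
    ultimately show "(u' has_real_derivative - (real (n - 1) / r) * u' r - double_power p \<omega> (u r)) (at r)"
      by simp
  qed (use d in auto)
  then show ?thesis by (rule that)
qed

theorem theorem1: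
  fixes n :: nat and p \<omega> :: real
  assumes "n \<ge> 1" and "p > 1" and "\<omega> \<in> {a_crit p..<omega_crit p}"
  shows "\<exists>!u. u \<in> extensional {0..} \<and> positive_solution n p \<omega> u"
proof -
  define f where "f = double_power p \<omega>"
  have \<omega>: "a_crit p \<le> \<omega>" "\<omega> < omega_crit p" using assms(3) by auto
  obtain L F \<beta> b \<delta> \<kappa> where
    gsn: "ground_state_nonlinearity (\<lambda>x. f (max 0 (min b x))) L F \<beta> b \<delta> \<kappa>"
    and f_neg: "\<forall>x>b. f x < 0"
    by (rule double_power_ground_state_nonlinearity[OF assms(2) \<omega>, folded f_def]) (rule that)
  define g where "g = (\<lambda>x. f (max 0 (min b x)))"
  interpret ground_state_nonlinearity g L "n - 1" F \<beta> b \<delta> \<kappa>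
    using gsn unfolding g_def .
  have g_eq: "g x = f x" if "0 \<le> x" "x \<le> b" for x using that by (simp add: g_def)
  have gs: "\<exists>v. ground_state u v" if u: "positive_solution n p \<omega> u" for u
  proof -
    have pos: "u r > 0" if "r \<ge> 0" for r using u that by (simp add: positive_solution_def)
    have lim: "(u \<longlongrightarrow> 0) at_top" using u by (simp add: positive_solution_def)
    obtain v where s: "radial_sol (n - 1) f u v"
      using positive_solution_radial_sol[OF assms(1) u] unfolding f_def by blast
    have le: "u r \<le> b" if "r \<ge> 0" for r
      by (rule decaying_radial_sol_le[OF s pos lim f_neg[rule_format] that])
    have s': "sol u v"
      using s g_eq[OF less_imp_le[OF pos] le] by (simp add: radial_sol_def)
    have "u r \<noteq> b" if r: "r \<ge> 0" for r
    proof
      assume ub: "u r = b"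
      have const: "sol (\<lambda>_. b) (\<lambda>_. 0)" by (rule radial_sol_const) (simp add: g_top)
      have "u t = b" if "t \<ge> 0" for t
      proof (cases "r = 0")
        case True
        then show ?thesis using radial_sol_unique[OF s' const _ that] ub by simp
      next
        case False
        then have r0: "r > 0" using r by simp
        have "v r = 0"
          by (rule DERIV_local_max[OF radial_sol_u[OF s' r0] r0]) (use le ub in auto)
        then show ?thesis using radial_sol_unique_interior[OF s' const r0 ub _ that] by simp
      qed
      then have "eventually (\<lambda>t. u t = b) at_top" by (intro eventually_at_top_linorderI[of 0])
      then have "(u \<longlongrightarrow> b) at_top" by (rule tendsto_eventually)
      then show False using tendsto_unique[OF _ lim] b_pos by force
    qed
    then have "u r < b" if "r \<ge> 0" for r using le[OF that] that by (simp add: less_le)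
    then have "ground_state u v" using s' pos lim unfolding ground_state_def by blast
    then show ?thesis by blast
  qed
  obtain u v a where uv: "ground_state u v" and a: "continuous_on {0..} a"
      "\<And>r. r \<ge> 0 \<Longrightarrow> (v has_real_derivative a r) (at r within {0..})"
    using ground_state_exists by blast
  note s = ground_state_sol[OF uv]
  define w where "w = restrict u {0..}"
  have w: "w r = u r" if "r \<ge> 0" for r using that by (simp add: w_def)
  have w': "(w has_real_derivative v r) (at r within {0..})" if r: "r \<ge> 0" for r
  proof -
    have "(u has_real_derivative v r) (at r within {0..})" using s r by (simp add: radial_sol_def)
    then show ?thesis
      by (rule has_field_derivative_transform_within[OF _ zero_less_one]) (use r w in auto)
  qed
  have eq: "a r + (real n - 1) / r * v r - \<omega> * w r + w r powr p - w r powr (2 * p - 1) = 0"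
    if r: "r > 0" for r
  proof -
    have "(v has_real_derivative a r) (at r)" using a(2)[of r] within_Ici_eq_at[OF r] r by simp
    then have "a r = - (real (n - 1) / r) * v r - g (u r)"
      using radial_sol_v[OF s r] by (rule DERIV_unique)
    moreover have "g (u r) = double_power p \<omega> (w r)"
      using g_eq[of "u r"] ground_state_pos[OF uv, of r] ground_state_less[OF uv, of r] w[of r] r
      by (simp add: f_def)
    ultimately show ?thesis using assms(1) by (simp add: double_power_def)
  qed
  have "\<forall>r\<ge>0. w r > 0" using w ground_state_pos[OF uv] by simp
  moreover have "(w \<longlongrightarrow> 0) at_top"
  proof -
    have "eventually (\<lambda>r. u r = w r) at_top"
      by (rule eventually_at_top_linorderI[of 0]) (simp add: w)
    with ground_state_lim[OF uv] show ?thesis by (rule Lim_transform_eventually)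
  qed
  ultimately have "positive_solution n p \<omega> w"
    unfolding positive_solution_def using w' a eq radial_sol_v0[OF s] by blast
  then show ?thesis
  proof (intro ex1I[of _ w] conjI)
    show "w \<in> extensional {0..}" by (simp add: w_def)
    fix u1 assume u1: "u1 \<in> extensional {0..} \<and> positive_solution n p \<omega> u1"
    obtain v1 where v1: "ground_state u1 v1" using gs u1 by blast
    show "u1 = w"
    proof (rule extensionalityI)
      show "u1 \<in> extensional {0..}" using u1 by simp
      show "w \<in> extensional {0..}" by (simp add: w_def)
      fix r :: real assume "r \<in> {0..}"
      then show "u1 r = w r" using ground_state_unique[OF v1 uv, of r] w by simp
    qed
  qed
qed

end
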